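(* Let $I$ be a square-free monomial ideal in $S=k[x_1,\ldots,x_n]$ ($k$ a field) such that every variable $x_i$ divides at least one minimal monomial generator of $I$. Let $\mathbf{m}_1,\ldots,\mathbf{m}_s$ be a well ordered cover of $I$, let $1\leq a\leq s-1$, and set $$\mathbf{m}=\mathrm{lcm}(\mathbf{m}_1,\ldots,\mathbf{m}_a)\quad\text{and}\quad \mathbf{m}'=\mathrm{lcm}(\mathbf{m}_{a+1},\ldots,\mathbf{m}_s).$$ Suppose one of the following conditions holds: 1. $I_{[\mathbf{m}]}=(\mathbf{m}_1,\ldots,\mathbf{m}_a)$; or 2. $\gcd(\mathbf{m},\mathbf{m}')=1$. Then $\mathbf{m}$ and $\mathbf{m}'$ are lattice complements in $\mathrm{LCM}(I)$ and $\beta_{a,\mathbf{m}}(S/I)\neq 0$. In particular, $$t_s\leq t_a+t_{s-a}.$$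
   Context: "Generators" of a monomial ideal always means its minimal monomial generators. A set of generators of a square-free monomial ideal $I$ is a cover of $I$ if every variable dividing some generator of $I$ divides some element of the set; it is a minimal cover if no proper subset is a cover. A sequence $\mathbf{m}_1,\ldots,\mathbf{m}_s$ of (distinct) generators of $I$ is a well ordered cover of $I$ if $\{\mathbf{m}_1,\ldots,\mathbf{m}_s\}$ is a minimal cover of $I$ and for every generator $\mathbf{n}\notin\{\mathbf{m}_1,\ldots,\mathbf{m}_s\}$ of $I$ there is an index $1\leq j\leq s-1$ with $\mathbf{m}_j\mid \mathrm{lcm}(\mathbf{n},\mathbf{m}_{j+1},\ldots,\mathbf{m}_s)$. $\mathrm{LCM}(I)$ is the lattice, ordered by divisibility, of least common multiples of subsets of the generators of $I$ (with $\mathrm{lcm}(\emptyset)=1$). Two monomials $\mathbf{m},\mathbf{m}'\in\mathrm{LCM}(I)$ are lattice complements if $\mathrm{lcm}(\mathbf{m},\mathbf{m}')=x_1\cdots x_n$ and $\gcd(\mathbf{m},\mathbf{m}')\notin I$. For a square-free monomial $\mathbf{m}$, $I_{[\mathbf{m}]}$ is the ideal generated by those generators of $I$ that divide $\mathbf{m}$. $\beta_{i,j}(S/I)$ and $\beta_{i,\mathbf{m}}(S/I)$ denote the graded and the multigraded Betti numbers of $S/I$ over $S$, and $t_i=\max\{j : \beta_{i,j}(S/I)\neq 0\}$. *)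

theory Defs
  imports
    "HOL-Library.Poly_Mapping"
    "HOL-Library.Function_Algebras"
    "Jordan_Normal_Form.Matrix_Kernel"
begin

text \<open>
  The variables are the elements of a finite type \<open>'x\<close>, so \<open>n = CARD('x)\<close>.  A monomial is its
  exponent vector \<open>m :: 'x \<Rightarrow> nat\<close>.  In the pointwise lattice structure on these functions
  \<open>m \<le> m'\<close> is divisibility, \<open>sup\<close> is the least common multiple, \<open>inf\<close> is the greatest common
  divisor, \<open>0\<close> is the monomial 1, and \<open>m x \<noteq> 0\<close> says that the variable \<open>x\<close> divides \<open>m\<close>.
  The polynomial ring is the monoid ring of the (additive) monoid of exponent vectors; its
  ring structure is the one of \<open>Poly_Mapping\<close>.
\<close>

type_synonym 'x mon = "'x \<Rightarrow> nat"
type_synonym ('x, 'k) poly_ring = "('x \<Rightarrow> nat) \<Rightarrow>\<^sub>0 'k"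

definition mono_poly :: "'x mon \<Rightarrow> ('x, 'k::field) poly_ring" where
  "mono_poly m = Poly_Mapping.single m 1"

definition ideal_gen :: "('x, 'k::field) poly_ring set \<Rightarrow> ('x, 'k) poly_ring set" where
  "ideal_gen B = Modules.module.span (*) B"

definition variable_mon :: "'x \<Rightarrow> 'x mon" where
  "variable_mon x = (\<lambda>y. if y = x then 1 else 0)"

definition irrelevant_ideal :: "('x, 'k::field) poly_ring set" where
  "irrelevant_ideal = ideal_gen (range (\<lambda>x. mono_poly (variable_mon x)))"

definition total_deg :: "'x::finite mon \<Rightarrow> nat" where
  "total_deg m = (\<Sum>x\<in>UNIV. m x)"


subsection \<open>Square-free monomial ideals\<close>

definition squarefree_mon :: "'x mon \<Rightarrow> bool" where
  "squarefree_mon m \<longleftrightarrow> (\<forall>x. m x \<le> 1)"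

definition squarefree_monomial_ideal :: "('x, 'k::field) poly_ring set \<Rightarrow> bool" where
  "squarefree_monomial_ideal I \<longleftrightarrow>
     (\<exists>G. (\<forall>g\<in>G. squarefree_mon g) \<and> I = ideal_gen (mono_poly ` G))"

text \<open>
  The minimal monomial generators are the monomials of \<open>I\<close> that are minimal with respect to
  divisibility; \<open>gens_iff_minimal_generating_set\<close> below identifies them as the unique
  irredundant monomial generating set.
\<close>

definition gens :: "('x, 'k::field) poly_ring set \<Rightarrow> 'x mon set" where
  "gens I = {m. mono_poly m \<in> I \<and> (\<forall>m'. mono_poly m' \<in> I \<and> m' \<le> m \<longrightarrow> m' = m)}"

text \<open>In \<open>nat\<close> the supremum of the empty set is \<open>0\<close>, so the least common multiple of no
  monomials is 1.  Only meaningful for finite \<open>A\<close>.\<close>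

definition lcm_mon :: "'x mon set \<Rightarrow> 'x mon" where
  "lcm_mon A = (\<lambda>x. SUP m\<in>A. m x)"

definition LCM_lattice :: "('x, 'k::field) poly_ring set \<Rightarrow> 'x mon set" where
  "LCM_lattice I = {lcm_mon A | A. A \<subseteq> gens I}"

definition lattice_complements ::
    "('x, 'k::field) poly_ring set \<Rightarrow> 'x mon \<Rightarrow> 'x mon \<Rightarrow> bool" where
  "lattice_complements I m m' \<longleftrightarrow>
     m \<in> LCM_lattice I \<and> m' \<in> LCM_lattice I \<and>
     sup m m' = (\<lambda>_. 1) \<and> mono_poly (inf m m') \<notin> I"

definition restrict_ideal ::
    "('x, 'k::field) poly_ring set \<Rightarrow> 'x mon \<Rightarrow> ('x, 'k) poly_ring set" where
  "restrict_ideal I m = ideal_gen (mono_poly ` {g \<in> gens I. g \<le> m})"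


subsection \<open>Well ordered covers\<close>

definition is_cover :: "('x, 'k::field) poly_ring set \<Rightarrow> 'x mon set \<Rightarrow> bool" where
  "is_cover I C \<longleftrightarrow>
     C \<subseteq> gens I \<and> (\<forall>x. (\<exists>g\<in>gens I. g x \<noteq> 0) \<longrightarrow> (\<exists>c\<in>C. c x \<noteq> 0))"

definition is_minimal_cover :: "('x, 'k::field) poly_ring set \<Rightarrow> 'x mon set \<Rightarrow> bool" where
  "is_minimal_cover I C \<longleftrightarrow> is_cover I C \<and> (\<forall>C'. C' \<subset> C \<longrightarrow> \<not> is_cover I C')"

text \<open>Lists are indexed from 0: for \<open>j < s - 1\<close> the entry \<open>ms ! j\<close> is the (j+1)-st generator
  of the sequence and \<open>drop (Suc j) ms\<close> consists of all later ones.\<close>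

definition well_ordered_cover :: "('x, 'k::field) poly_ring set \<Rightarrow> 'x mon list \<Rightarrow> bool" where
  "well_ordered_cover I ms \<longleftrightarrow>
     distinct ms \<and> is_minimal_cover I (set ms) \<and>
     (\<forall>n \<in> gens I - set ms. \<exists>j. Suc j < length ms \<and>
        ms ! j \<le> lcm_mon (insert n (set (drop (Suc j) ms))))"


subsection \<open>Graded minimal free resolutions and Betti numbers\<close>

text \<open>
  A sequence of finitely generated graded free modules and maps between them.  The list
  \<open>degs F i\<close> contains the degrees of the basis elements of the \<open>i\<close>-th free module \<open>F\<^sub>i\<close>, so
  that \<open>F\<^sub>i\<close> is the direct sum of the shifts \<open>S(-d)\<close> over the entries \<open>d\<close> of \<open>degs F i\<close>.
  The matrix \<open>diff F i\<close> represents the map from \<open>F\<^sub>i\<^sub>+\<^sub>1\<close> to \<open>F\<^sub>i\<close>.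
\<close>

record ('d, 's) graded_complex =
  degs :: "nat \<Rightarrow> 'd list"
  diff :: "nat \<Rightarrow> 's mat"

definition rnk :: "('d, 's) graded_complex \<Rightarrow> nat \<Rightarrow> nat" where
  "rnk F i = length (degs F i)"

text \<open>
  Everything is relative to a grading \<open>\<delta>\<close> that assigns to each monomial its degree.  The fine
  (multi-)grading is \<open>\<delta> = (\<lambda>m. m)\<close>, the standard grading is \<open>\<delta> = total_deg\<close>.  The third
  clause says that the maps are homogeneous of degree 0.  The last two clauses express
  exactness of \<open>\<dots> \<rightarrow> F\<^sub>2 \<rightarrow> F\<^sub>1 \<rightarrow> S \<rightarrow> S/I \<rightarrow> 0\<close>; the module \<open>F\<^sub>0\<close> is \<open>S\<close> itself, which is
  the right choice for a minimal resolution of \<open>S/I\<close> for a proper ideal \<open>I\<close>.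
\<close>

definition graded_free_resolution ::
    "('x mon \<Rightarrow> 'd::comm_monoid_add) \<Rightarrow> ('x, 'k::field) poly_ring set \<Rightarrow>
     ('d, ('x, 'k) poly_ring) graded_complex \<Rightarrow> bool" where
  "graded_free_resolution \<delta> I F \<longleftrightarrow>
     degs F 0 = [0] \<and>
     (\<forall>i. diff F i \<in> carrier_mat (rnk F i) (rnk F (Suc i))) \<and>
     (\<forall>i. \<forall>r < rnk F i. \<forall>c < rnk F (Suc i). \<forall>u \<in> Poly_Mapping.keys (diff F i $$ (r, c)).
        \<delta> u + degs F i ! r = degs F (Suc i) ! c) \<and>
     {(diff F 0 *\<^sub>v w) $ 0 | w. w \<in> carrier_vec (rnk F 1)} = I \<and>
     (\<forall>i. {diff F (Suc i) *\<^sub>v w | w. w \<in> carrier_vec (rnk F (Suc (Suc i)))} =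
            mat_kernel (diff F i))"

definition minimal_graded_free_resolution ::
    "('x mon \<Rightarrow> 'd::comm_monoid_add) \<Rightarrow> ('x, 'k::field) poly_ring set \<Rightarrow>
     ('d, ('x, 'k) poly_ring) graded_complex \<Rightarrow> bool" where
  "minimal_graded_free_resolution \<delta> I F \<longleftrightarrow>
     graded_free_resolution \<delta> I F \<and>
     (\<forall>i. \<forall>r < rnk F i. \<forall>c < rnk F (Suc i). diff F i $$ (r, c) \<in> irrelevant_ideal)"

text \<open>
  The Betti number of \<open>S/I\<close> in homological degree \<open>i\<close> and internal degree \<open>d\<close> is the number of
  summands \<open>S(-d)\<close> of \<open>F\<^sub>i\<close> in the minimal graded free resolution \<open>F\<close> of \<open>S/I\<close>.  For the two
  gradings used here such a resolution of a proper monomial ideal exists and is unique up to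
  isomorphism, so the choice is immaterial.
\<close>

definition betti_wrt ::
    "('x mon \<Rightarrow> 'd::comm_monoid_add) \<Rightarrow> ('x, 'k::field) poly_ring set \<Rightarrow> nat \<Rightarrow> 'd \<Rightarrow> nat" where
  "betti_wrt \<delta> I i d = count_list (degs (SOME F. minimal_graded_free_resolution \<delta> I F) i) d"

definition multigraded_betti :: "('x, 'k::field) poly_ring set \<Rightarrow> nat \<Rightarrow> 'x mon \<Rightarrow> nat" where
  "multigraded_betti I i m = betti_wrt (\<lambda>u. u) I i m"

definition graded_betti :: "('x::finite, 'k::field) poly_ring set \<Rightarrow> nat \<Rightarrow> nat \<Rightarrow> nat" where
  "graded_betti I i j = betti_wrt total_deg I i j"

text \<open>The maximum is over a finite set; it is meaningful only if \<open>F\<^sub>i\<close> is nonzero.\<close>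

definition t_max :: "('x::finite, 'k::field) poly_ring set \<Rightarrow> nat \<Rightarrow> nat" where
  "t_max I i = Max {j. graded_betti I i j \<noteq> 0}"


subsection \<open>The minimal monomial generators form the minimal generating set\<close>

lemma module_poly_ring: "Modules.module ((*) :: ('x, 'k::field) poly_ring \<Rightarrow> _)"
  by unfold_locales (auto simp: algebra_simps)

lemma mono_poly_add: "mono_poly (a + b) = mono_poly a * mono_poly b"
  by (simp add: mono_poly_def mult_single)

lemma keys_ideal_gen:
  assumes "f \<in> ideal_gen (mono_poly ` G)" "u \<in> Poly_Mapping.keys f"
  shows "\<exists>g\<in>G. g \<le> u"
proof -
  interpret M: Modules.module "(*) :: ('a, 'b) poly_ring \<Rightarrow> _" by (rule module_poly_ring)
  let ?T = "{f :: ('a, 'b) poly_ring. \<forall>u\<in>Poly_Mapping.keys f. \<exists>g\<in>G. g \<le> u}"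
  have "M.subspace ?T"
  proof (rule M.subspaceI)
    fix p q :: "('a, 'b) poly_ring" assume "p \<in> ?T" "q \<in> ?T"
    then show "p + q \<in> ?T" using Poly_Mapping.keys_add[of p q] by blast
  next
    fix c p :: "('a, 'b) poly_ring" assume p: "p \<in> ?T"
    have "\<exists>g\<in>G. g \<le> u" if "u \<in> Poly_Mapping.keys (c * p)" for u
    proof -
      from that Poly_Mapping.keys_mult[of c p] obtain a b
        where "u = a + b" "b \<in> Poly_Mapping.keys p" by blast
      moreover from this p obtain g where "g \<in> G" "g \<le> b" by blast
      ultimately show ?thesis
        by (intro bexI[of _ g]) (auto simp: le_fun_def intro: trans_le_add2)
    qed
    then show "c * p \<in> ?T" by blast
  qed simp
  moreover have "mono_poly ` G \<subseteq> ?T" by (auto simp: mono_poly_def)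
  ultimately have "ideal_gen (mono_poly ` G) \<subseteq> ?T"
    unfolding ideal_gen_def by (intro M.span_minimal)
  with assms show ?thesis by blast
qed

lemma mono_poly_in_ideal_gen_iff:
  "mono_poly m \<in> (ideal_gen (mono_poly ` G) :: ('x, 'k::field) poly_ring set) \<longleftrightarrow> (\<exists>g\<in>G. g \<le> m)"
proof
  assume "mono_poly m \<in> (ideal_gen (mono_poly ` G) :: ('x, 'k) poly_ring set)"
  then show "\<exists>g\<in>G. g \<le> m"
    by (rule keys_ideal_gen) (simp add: mono_poly_def)
next
  interpret M: Modules.module "(*) :: ('x, 'k) poly_ring \<Rightarrow> _" by (rule module_poly_ring)
  assume "\<exists>g\<in>G. g \<le> m"
  then obtain g where g: "g \<in> G" "g \<le> m" by blast
  then have "m = (\<lambda>x. m x - g x) + g" by (auto simp: fun_eq_iff le_fun_def)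
  then have "mono_poly m = (mono_poly (\<lambda>x. m x - g x) :: ('x, 'k) poly_ring) * mono_poly g"
    by (metis mono_poly_add)
  then show "mono_poly m \<in> (ideal_gen (mono_poly ` G) :: ('x, 'k) poly_ring set)"
    unfolding ideal_gen_def using g by (simp add: M.span_scale M.span_base)
qed

lemma gens_ideal_gen_le:
  fixes I :: "('x::finite, 'k::field) poly_ring set"
  assumes "mono_poly m \<in> I"
  shows "\<exists>g\<in>gens I. g \<le> m"
  using assms
proof (induction "total_deg m" arbitrary: m rule: less_induct)
  case less
  show ?case
  proof (cases "m \<in> gens I")
    case False
    with less.prems obtain m' where m': "mono_poly m' \<in> I" "m' \<le> m" "m' \<noteq> m"
      by (auto simp: gens_def)
    from m'(2,3) obtain x where "m' x < m x"
      by (metis le_fun_def order_antisym not_le)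
    with m'(2) have "total_deg m' < total_deg m"
      unfolding total_deg_def by (intro sum_strict_mono_ex1) (auto simp: le_fun_def)
    from less.hyps[OF this m'(1)] m'(2) show ?thesis by (meson order_trans)
  qed auto
qed

lemma gens_iff_minimal_generating_set:
  fixes I :: "('x::finite, 'k::field) poly_ring set"
  assumes "I = ideal_gen (mono_poly ` G)"
  shows "gens I = H \<longleftrightarrow>
    ideal_gen (mono_poly ` H) = I \<and> (\<forall>H'. H' \<subset> H \<longrightarrow> ideal_gen (mono_poly ` H') \<noteq> I)"
proof -
  interpret M: Modules.module "(*) :: ('x, 'k) poly_ring \<Rightarrow> _" by (rule module_poly_ring)
  have sub: "gens I \<subseteq> H" if "ideal_gen (mono_poly ` H) = I" for H
  proof
    fix g assume g: "g \<in> gens I"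
    then have "mono_poly g \<in> (ideal_gen (mono_poly ` H) :: ('x, 'k) poly_ring set)"
      using that by (simp add: gens_def)
    then obtain h where h: "h \<in> H" "h \<le> g" by (auto simp: mono_poly_in_ideal_gen_iff)
    have "mono_poly h \<in> I" using h(1) that mono_poly_in_ideal_gen_iff by blast
    with g h show "g \<in> H" by (auto simp: gens_def)
  qed
  have gen: "ideal_gen (mono_poly ` gens I) = I"
  proof
    have "mono_poly ` gens I \<subseteq> I" by (auto simp: gens_def)
    then show "ideal_gen (mono_poly ` gens I) \<subseteq> I"
      unfolding assms ideal_gen_def by (intro M.span_minimal) auto
    have "mono_poly ` G \<subseteq> (ideal_gen (mono_poly ` gens I) :: ('x, 'k) poly_ring set)"
    proof (intro image_subsetI)
      fix g assume "g \<in> G"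
      then have "(mono_poly g :: ('x, 'k) poly_ring) \<in> I" unfolding assms ideal_gen_def by (intro M.span_base) auto
      from gens_ideal_gen_le[OF this]
      show "mono_poly g \<in> (ideal_gen (mono_poly ` gens I) :: ('x, 'k) poly_ring set)"
        by (simp add: mono_poly_in_ideal_gen_iff)
    qed
    then show "I \<subseteq> ideal_gen (mono_poly ` gens I)"
      unfolding assms ideal_gen_def by (intro M.span_minimal) auto
  qed
  show ?thesis using sub gen by blast
qed

end

theory Submission
  imports Defs
begin

text \<open>
  Order the generators of \<open>I\<close> so that a given irredundant sequence \<open>n\<^sub>1, \<dots>, n\<^sub>r\<close> comes first, and
  form the Lyubeznik resolution of \<open>S/I\<close> for this order: its basis consists of the rooted sets of
  generators, and the basis element of a set has the least common multiple of the set as its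
  multidegree.  If the sequence satisfies the ordering condition of a well ordered cover among
  the generators dividing \<open>u = lcm(n\<^sub>1, \<dots>, n\<^sub>r)\<close>, then \<open>A = {n\<^sub>1, \<dots>, n\<^sub>r}\<close> is rooted, no set
  obtained from \<open>A\<close> by removing one element has the same least common multiple, and no set
  obtained by adding a divisor of \<open>u\<close> is rooted.  So, modulo the irrelevant ideal, the basis
  element of \<open>A\<close> is a cycle that does not occur in any boundary, and Tor is nonzero in homological
  degree \<open>r\<close> and multidegree \<open>u\<close>; this is \<open>well_ordered_degree\<close>.

  It applies to three sequences: the whole cover, its tail \<open>m\<^sub>a\<^sub>+\<^sub>1, \<dots>, m\<^sub>s\<close> (for which the ordering
  condition is inherited, because every member of a minimal cover has a private variable), and its
  head \<open>m\<^sub>1, \<dots>, m\<^sub>a\<close>.  For the head the two alternative hypotheses enter: under the first one there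
  are no further generators dividing \<open>m\<close>, under the second one coprimality confines the ordering
  condition to the head (\<open>well_ordered_tail\<close>, \<open>well_ordered_head\<close>).  The head gives the
  nonvanishing Betti number, and head and tail give \<open>t\<^sub>a \<ge> deg m\<close> and \<open>t\<^sub>s\<^sub>-\<^sub>a \<ge> deg m'\<close>.  Since
  \<open>lcm(m, m')\<close> is the product of all \<open>n\<close> variables, \<open>deg m + deg m' \<ge> n\<close>.  Finally \<open>t\<^sub>s \<le> n\<close>, because
  a minimal resolution has only squarefree multidegrees; the whole cover is used to see that
  \<open>t\<^sub>s\<close> is the maximum of a nonempty set.

  Betti numbers are read off an arbitrary minimal resolution, in the fine or in the standard
  grading.  Two facts make such a choice harmless: a minimal resolution exists
  (\<open>minimal_resolution_exists\<close>), and a basis element that represents a nonzero class of Tor in one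
  resolution forces a basis element of the same degree in every other one
  (\<open>degree_in_every_resolution\<close>).
\<close>


section \<open>Homogeneous components and constant terms of polynomials\<close>

definition restrict_keys :: "('a \<Rightarrow> bool) \<Rightarrow> ('a \<Rightarrow>\<^sub>0 'b::zero) \<Rightarrow> 'a \<Rightarrow>\<^sub>0 'b" where
  "restrict_keys Q f = Poly_Mapping.mapp (\<lambda>u c. c when Q u) f"

lemma lookup_restrict_keys:
  "Poly_Mapping.lookup (restrict_keys Q f) u = (Poly_Mapping.lookup f u when Q u)"
  by (auto simp: restrict_keys_def lookup_mapp when_def in_keys_iff)

lemma keys_restrict_keys: "Poly_Mapping.keys (restrict_keys Q f) = {u \<in> Poly_Mapping.keys f. Q u}"
  by (auto simp: in_keys_iff lookup_restrict_keys when_def split: if_splits)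

lemma restrict_keys_add:
  fixes f g :: "'a \<Rightarrow>\<^sub>0 'b::comm_monoid_add"
  shows "restrict_keys Q (f + g) = restrict_keys Q f + restrict_keys Q g"
  by (intro poly_mapping_eqI) (auto simp: lookup_restrict_keys lookup_add when_def)

lemma restrict_keys_sum:
  fixes f :: "'i \<Rightarrow> 'a \<Rightarrow>\<^sub>0 'b::comm_monoid_add"
  shows "restrict_keys Q (sum f A) = (\<Sum>i\<in>A. restrict_keys Q (f i))"
  by (intro poly_mapping_eqI) (auto simp: lookup_restrict_keys lookup_sum when_def)

lemma restrict_keys_all: "(\<And>u. u \<in> Poly_Mapping.keys f \<Longrightarrow> Q u) \<Longrightarrow> restrict_keys Q f = f"
  by (intro poly_mapping_eqI) (auto simp: lookup_restrict_keys when_def in_keys_iff)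

lemma restrict_keys_none: "(\<And>u. u \<in> Poly_Mapping.keys f \<Longrightarrow> \<not> Q u) \<Longrightarrow> restrict_keys Q f = 0"
  by (intro poly_mapping_eqI) (auto simp: lookup_restrict_keys when_def in_keys_iff)

lemma restrict_keys_split:
  fixes f :: "'a \<Rightarrow>\<^sub>0 'b::comm_monoid_add"
  shows "f = restrict_keys Q f + restrict_keys (\<lambda>u. \<not> Q u) f"
  by (intro poly_mapping_eqI) (auto simp: lookup_restrict_keys lookup_add when_def)

text \<open>
  Multiplication by a homogeneous element shifts homogeneous components: if the monomials of
  \<open>f\<close> move \<open>R\<close> exactly into \<open>Q\<close>, then taking the \<open>Q\<close>-part of \<open>f * g\<close> amounts to taking the
  \<open>R\<close>-part of \<open>g\<close>.
\<close>

lemma restrict_keys_mult: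
  fixes f g :: "'a::monoid_add \<Rightarrow>\<^sub>0 'b::semiring_0"
  assumes "\<And>u t. u \<in> Poly_Mapping.keys f \<Longrightarrow> Q (u + t) \<longleftrightarrow> R t"
  shows "restrict_keys Q (f * g) = f * restrict_keys R g"
proof -
  have sub: "\<exists>u v. t = u + v \<and> u \<in> Poly_Mapping.keys f \<and> v \<in> Poly_Mapping.keys h"
    if "t \<in> Poly_Mapping.keys (f * h)" for t h
    using that keys_mult[of f h] by blast
  have "f * g = f * restrict_keys R g + f * restrict_keys (\<lambda>u. \<not> R u) g"
    by (metis restrict_keys_split distrib_left)
  moreover have "restrict_keys Q (f * restrict_keys R g) = f * restrict_keys R g"
    by (rule restrict_keys_all, drule sub) (auto simp: keys_restrict_keys assms)
  moreover have "restrict_keys Q (f * restrict_keys (\<lambda>u. \<not> R u) g) = 0"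
    by (rule restrict_keys_none, drule sub) (auto simp: keys_restrict_keys assms)
  ultimately show ?thesis by (simp add: restrict_keys_add)
qed

abbreviation const_term :: "('x, 'k::field) poly_ring \<Rightarrow> 'k" where
  "const_term f \<equiv> Poly_Mapping.lookup f 0"

text \<open>A sum of exponent vectors vanishes only if both summands do, so constant terms multiply.\<close>

lemma const_term_mult:
  fixes f g :: "('x, 'k::field) poly_ring"
  shows "const_term (f * g) = const_term f * const_term g"
proof -
  let ?h = "restrict_keys (\<lambda>u. u \<noteq> 0) f"
  have "f = Poly_Mapping.single 0 (const_term f) + ?h"
    by (intro poly_mapping_eqI) (auto simp: lookup_restrict_keys lookup_add lookup_single when_def)
  then have "f * g = Poly_Mapping.single 0 (const_term f) * g + ?h * g"
    by (metis distrib_right)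
  moreover have "const_term (?h * g) = 0"
  proof (rule ccontr)
    assume "const_term (?h * g) \<noteq> 0"
    then have "0 \<in> Poly_Mapping.keys (?h * g)" by (simp add: in_keys_iff)
    then obtain u v where "(0 :: 'x \<Rightarrow> nat) = u + v" "u \<in> Poly_Mapping.keys ?h"
      using keys_mult[of ?h g] by blast
    then show False by (auto simp: keys_restrict_keys fun_eq_iff)
  qed
  moreover have "const_term (Poly_Mapping.single 0 (const_term f) * g) = const_term f * const_term g"
    by (simp add: mult_map_scale_conv_mult[symmetric] Poly_Mapping.map.rep_eq when_def)
  ultimately show ?thesis by (simp add: lookup_add)
qed

lemma const_term_irrelevant:
  fixes f :: "('x, 'k::field) poly_ring"
  assumes "f \<in> irrelevant_ideal"
  shows "const_term f = 0"
proof (rule ccontr)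
  assume "const_term f \<noteq> 0"
  then have 0: "0 \<in> Poly_Mapping.keys f" by (simp add: in_keys_iff)
  have "f \<in> ideal_gen (mono_poly ` range variable_mon)"
    using assms by (simp add: irrelevant_ideal_def image_image)
  from keys_ideal_gen[OF this 0] obtain x :: 'x where "variable_mon x \<le> 0" by auto
  then show False by (auto simp: le_fun_def variable_mon_def dest: spec[of _ x])
qed

lemma single_irrelevant:
  assumes "u \<noteq> 0"
  shows "(Poly_Mapping.single u c :: ('x, 'k::field) poly_ring) \<in> irrelevant_ideal"
proof -
  interpret M: Modules.module "(*) :: ('x, 'k) poly_ring \<Rightarrow> _" by (rule module_poly_ring)
  obtain x where "u x \<noteq> 0" using assms by (auto simp: fun_eq_iff)
  then have "variable_mon x \<le> u" by (auto simp: le_fun_def variable_mon_def)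
  then have "(mono_poly u :: ('x, 'k) poly_ring) \<in> ideal_gen (mono_poly ` range variable_mon)"
    unfolding mono_poly_in_ideal_gen_iff by blast
  then have "Poly_Mapping.single 0 c * mono_poly u \<in> (irrelevant_ideal :: ('x, 'k) poly_ring set)"
    unfolding irrelevant_ideal_def ideal_gen_def image_image by (rule M.span_scale)
  then show ?thesis by (simp add: mono_poly_def mult_single)
qed

lemma zero_irrelevant: "(0 :: ('x, 'k::field) poly_ring) \<in> irrelevant_ideal"
proof -
  interpret M: Modules.module "(*) :: ('x, 'k) poly_ring \<Rightarrow> _" by (rule module_poly_ring)
  show ?thesis unfolding irrelevant_ideal_def ideal_gen_def by (rule M.span_zero)
qed

section \<open>Homogeneous matrices\<close>

locale grading =
  fixes \<delta> :: "'x mon \<Rightarrow> 'd::comm_monoid_add"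
  assumes \<delta>_add: "\<delta> (u + v) = \<delta> u + \<delta> v" and \<delta>_zero: "\<delta> 0 = 0"
begin

text \<open>The equation on degrees says that the matrix represents a homogeneous map of degree 0 from the
  free module with basis degrees \<open>E\<close> to the one with basis degrees \<open>D\<close>.\<close>

definition hom_mat :: "'d list \<Rightarrow> 'd list \<Rightarrow> ('x, 'k::field) poly_ring mat \<Rightarrow> bool" where
  "hom_mat D E M \<longleftrightarrow> M \<in> carrier_mat (length D) (length E) \<and>
     (\<forall>r < length D. \<forall>c < length E. \<forall>u \<in> Poly_Mapping.keys (M $$ (r, c)). \<delta> u + D ! r = E ! c)"

lemma hom_mat_one: "hom_mat D D (1\<^sub>m (length D))"
  by (auto simp: hom_mat_def \<delta>_zero split: if_splits)

lemma hom_mat_zero: "hom_mat D E (0\<^sub>m (length D) (length E))"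
  by (auto simp: hom_mat_def)

lemma hom_mat_minus:
  assumes "hom_mat D E M" "hom_mat D E N"
  shows "hom_mat D E (M - N)"
  unfolding hom_mat_def
proof (intro conjI allI impI ballI)
  show "M - N \<in> carrier_mat (length D) (length E)" using assms by (auto simp: hom_mat_def)
next
  fix r c u assume "r < length D" "c < length E" "u \<in> Poly_Mapping.keys ((M - N) $$ (r, c))"
  moreover from this have "u \<in> Poly_Mapping.keys (M $$ (r, c)) \<or> u \<in> Poly_Mapping.keys (N $$ (r, c))"
    using assms by (auto simp: hom_mat_def in_keys_iff lookup_minus)
  ultimately show "\<delta> u + D ! r = E ! c" using assms unfolding hom_mat_def by blast
qed

lemma hom_mat_mult:
  assumes M: "hom_mat D E M" and N: "hom_mat E H N"
  shows "hom_mat D H (M * N)"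
  unfolding hom_mat_def
proof (intro conjI allI impI ballI)
  show "M * N \<in> carrier_mat (length D) (length H)" using assms by (auto simp: hom_mat_def)
next
  fix r c u assume rc: "r < length D" "c < length H" and u: "u \<in> Poly_Mapping.keys ((M * N) $$ (r, c))"
  have "(M * N) $$ (r, c) = (\<Sum>k<length E. M $$ (r, k) * N $$ (k, c))"
    using rc assms by (auto simp: hom_mat_def scalar_prod_def lessThan_atLeast0)
  with u obtain k where k: "k < length E" "u \<in> Poly_Mapping.keys (M $$ (r, k) * N $$ (k, c))"
    using keys_sum[of "\<lambda>k. M $$ (r, k) * N $$ (k, c)" "{..<length E}"] by auto
  from k(2) keys_mult obtain v w where vw: "u = v + w"
    "v \<in> Poly_Mapping.keys (M $$ (r, k))" "w \<in> Poly_Mapping.keys (N $$ (k, c))"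
    by (smt (verit, ccfv_threshold) in_mono mem_Collect_eq)
  have "\<delta> u + D ! r = \<delta> w + (\<delta> v + D ! r)" by (simp add: vw(1) \<delta>_add ac_simps)
  also have "\<dots> = H ! c" using vw rc k assms by (auto simp: hom_mat_def)
  finally show "\<delta> u + D ! r = H ! c" .
qed

text \<open>
  Since \<open>M\<close> is homogeneous, a homogeneous vector in its image is the image of the component of
  matching degree of any preimage.
\<close>

lemma homogeneous_preimage:
  assumes M: "hom_mat D E M" and v: "v \<in> carrier_vec (length E)"
    and hom: "\<And>r u. r < length D \<Longrightarrow> u \<in> Poly_Mapping.keys ((M *\<^sub>v v) $ r) \<Longrightarrow> \<delta> u + D ! r = d"
  shows "\<exists>w \<in> carrier_vec (length E). M *\<^sub>v w = M *\<^sub>v v \<and>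
    (\<forall>c < length E. \<forall>u \<in> Poly_Mapping.keys (w $ c). \<delta> u + E ! c = d)"
proof -
  define w where "w = vec (length E) (\<lambda>c. restrict_keys (\<lambda>u. \<delta> u + E ! c = d) (v $ c))"
  have entry: "(M *\<^sub>v z) $ r = (\<Sum>c<length E. M $$ (r, c) * z $ c)"
    if "z \<in> carrier_vec (length E)" "r < length D" for z r
    using that M by (auto simp: hom_mat_def scalar_prod_def lessThan_atLeast0)
  have "M *\<^sub>v w = M *\<^sub>v v"
  proof (rule eq_vecI)
    show "dim_vec (M *\<^sub>v w) = dim_vec (M *\<^sub>v v)" by simp
    fix r assume "r < dim_vec (M *\<^sub>v v)"
    then have r: "r < length D" using M by (auto simp: hom_mat_def)
    have shift: "\<delta> (u + t) + D ! r = d \<longleftrightarrow> \<delta> t + E ! c = d"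
      if "c < length E" "u \<in> Poly_Mapping.keys (M $$ (r, c))" for u t c
    proof -
      have "\<delta> u + D ! r = E ! c" using M r that by (simp add: hom_mat_def)
      moreover have "\<delta> (u + t) + D ! r = \<delta> t + (\<delta> u + D ! r)" by (simp add: \<delta>_add ac_simps)
      ultimately show ?thesis by simp
    qed
    have "(M *\<^sub>v v) $ r = restrict_keys (\<lambda>u. \<delta> u + D ! r = d) ((M *\<^sub>v v) $ r)"
      using hom[OF r] by (simp add: restrict_keys_all)
    also have "\<dots> = (\<Sum>c<length E. M $$ (r, c) * restrict_keys (\<lambda>u. \<delta> u + E ! c = d) (v $ c))"
      unfolding entry[OF v r] restrict_keys_sum
      by (intro sum.cong refl restrict_keys_mult) (simp add: shift)
    also have "\<dots> = (M *\<^sub>v w) $ r" by (subst entry) (auto simp: w_def r)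
    finally show "(M *\<^sub>v w) $ r = (M *\<^sub>v v) $ r" ..
  qed
  then show ?thesis by (intro bexI[of _ w]) (auto simp: w_def keys_restrict_keys)
qed

text \<open>Applied to each column of \<open>N\<close>, this factors homogeneous matrices through \<open>M\<close>.\<close>

lemma hom_mat_lift:
  assumes M: "hom_mat D E M" and N: "hom_mat D H N"
    and img: "\<And>c. c < length H \<Longrightarrow> \<exists>v \<in> carrier_vec (length E). M *\<^sub>v v = col N c"
  shows "\<exists>X. hom_mat E H X \<and> M * X = N"
proof -
  have "\<exists>w \<in> carrier_vec (length E). M *\<^sub>v w = col N c \<and>
      (\<forall>k < length E. \<forall>u \<in> Poly_Mapping.keys (w $ k). \<delta> u + E ! k = H ! c)"
    if c: "c < length H" for c
  proof -
    from img[OF c] obtain v where v: "v \<in> carrier_vec (length E)" "M *\<^sub>v v = col N c" by blast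
    have "\<delta> u + D ! r = H ! c" if "r < length D" "u \<in> Poly_Mapping.keys ((M *\<^sub>v v) $ r)" for r u
      using that N c unfolding v(2) by (auto simp: hom_mat_def)
    from homogeneous_preimage[OF M v(1) this] v(2) show ?thesis by simp
  qed
  then obtain w where w: "\<And>c. c < length H \<Longrightarrow> w c \<in> carrier_vec (length E) \<and> M *\<^sub>v w c = col N c \<and>
      (\<forall>k < length E. \<forall>u \<in> Poly_Mapping.keys (w c $ k). \<delta> u + E ! k = H ! c)"
    by metis
  define X where "X = mat (length E) (length H) (\<lambda>(k, c). w c $ k)"
  have col: "col X c = w c" if "c < length H" for c
    using w[OF that] that by (intro eq_vecI) (auto simp: X_def)
  have "hom_mat E H X" using w by (auto simp: hom_mat_def X_def)
  moreover have "M * X = N"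
  proof (rule eq_matI)
    fix r c assume "r < dim_row N" "c < dim_col N"
    with N have rc: "r < length D" "c < length H" by (auto simp: hom_mat_def)
    have "(M * X) $$ (r, c) = (M *\<^sub>v w c) $ r"
      using rc M col by (auto simp: hom_mat_def X_def)
    also have "\<dots> = N $$ (r, c)" using w[OF rc(2)] rc N by (auto simp: hom_mat_def)
    finally show "(M * X) $$ (r, c) = N $$ (r, c)" .
  qed (use M N in \<open>auto simp: hom_mat_def X_def\<close>)
  ultimately show ?thesis by blast
qed

end


section \<open>Comparison of graded free resolutions\<close>

context grading
begin

lemma resolution_hom_mat:
  "graded_free_resolution \<delta> I F \<Longrightarrow> hom_mat (degs F i) (degs F (Suc i)) (diff F i)"
  by (auto simp: graded_free_resolution_def hom_mat_def rnk_def)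

lemma resolution_diff_carrier:
  "graded_free_resolution \<delta> I F \<Longrightarrow> diff F i \<in> carrier_mat (rnk F i) (rnk F (Suc i))"
  by (auto simp: graded_free_resolution_def)

lemma mult_unit_vec:
  fixes A :: "'a::comm_ring_1 mat"
  assumes "A \<in> carrier_mat n m" "c < m"
  shows "A *\<^sub>v unit_vec m c = col A c"
  using assms by (intro eq_vecI) auto

lemma resolution_diff_diff:
  fixes F :: "('d, ('x, 'k::field) poly_ring) graded_complex"
  assumes F: "graded_free_resolution \<delta> I F"
  shows "diff F i * diff F (Suc i) = 0\<^sub>m (rnk F i) (rnk F (Suc (Suc i)))"
proof (rule eq_matI)
  note C = resolution_diff_carrier[OF F]
  fix r c assume "r < dim_row (0\<^sub>m (rnk F i) (rnk F (Suc (Suc i))) :: ('x, 'k) poly_ring mat)"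
    "c < dim_col (0\<^sub>m (rnk F i) (rnk F (Suc (Suc i))) :: ('x, 'k) poly_ring mat)"
  then have rc: "r < rnk F i" "c < rnk F (Suc (Suc i))" by auto
  let ?e = "unit_vec (rnk F (Suc (Suc i))) c :: ('x, 'k) poly_ring vec"
  have "diff F (Suc i) *\<^sub>v ?e \<in> mat_kernel (diff F i)"
    using F unfolding graded_free_resolution_def by (metis (mono_tags, lifting) mem_Collect_eq unit_vec_carrier)
  moreover have "diff F (Suc i) *\<^sub>v ?e = col (diff F (Suc i)) c"
    by (rule mult_unit_vec[OF C rc(2)])
  ultimately have "diff F i *\<^sub>v col (diff F (Suc i)) c = 0\<^sub>v (rnk F i)"
    using C[of i] by (simp add: mat_kernel)
  then have "(diff F i *\<^sub>v col (diff F (Suc i)) c) $ r = 0" using rc by simp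
  then show "(diff F i * diff F (Suc i)) $$ (r, c) = 0\<^sub>m (rnk F i) (rnk F (Suc (Suc i))) $$ (r, c)"
    using C[of i] C[of "Suc i"] rc by auto
qed (use resolution_diff_carrier[OF F] in auto)

text \<open>
  The lifting property: free modules are projective, so a homogeneous map into the cycles of a
  resolution factors through the next differential.
\<close>

lemma resolution_lift:
  assumes F: "graded_free_resolution \<delta> I F" and N: "hom_mat (degs F (Suc i)) H N"
    and z: "diff F i * N = 0\<^sub>m (rnk F i) (length H)"
  shows "\<exists>X. hom_mat (degs F (Suc (Suc i))) H X \<and> diff F (Suc i) * X = N"
proof (rule hom_mat_lift[OF resolution_hom_mat[OF F] N])
  note C = resolution_diff_carrier[OF F]
  have Nc: "N \<in> carrier_mat (rnk F (Suc i)) (length H)" using N by (simp add: hom_mat_def rnk_def)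
  fix c assume c: "c < length H"
  have "diff F i *\<^sub>v col N c = col (diff F i * N) c"
    by (rule col_mult2[OF C Nc c, symmetric])
  also have "\<dots> = 0\<^sub>v (rnk F i)" using z c by simp
  finally have "col N c \<in> mat_kernel (diff F i)"
    using C[of i] Nc c by (intro mat_kernelI) auto
  then show "\<exists>v\<in>carrier_vec (length (degs F (Suc (Suc i)))). diff F (Suc i) *\<^sub>v v = col N c"
    using F unfolding graded_free_resolution_def rnk_def by (smt (verit) mem_Collect_eq)
qed

text \<open>The comparison map over the identity of \<open>S\<close>, built up one homological degree at a time.\<close>

lemma chain_map_exists:
  fixes F G :: "('d, ('x, 'k::field) poly_ring) graded_complex"
  assumes F: "graded_free_resolution \<delta> I F" and G: "graded_free_resolution \<delta> I G"
  shows "\<exists>\<psi>. \<psi> 0 = 1\<^sub>m 1 \<and> (\<forall>i. hom_mat (degs F i) (degs G i) (\<psi> i) \<and>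
     diff F i * \<psi> (Suc i) = \<psi> i * diff G i)"
proof -
  note CF = resolution_diff_carrier[OF F] and CG = resolution_diff_carrier[OF G]
  have D0: "degs F 0 = [0]" "degs G 0 = [0]" and R0: "rnk F 0 = 1" "rnk G 0 = 1"
    using F G by (auto simp: graded_free_resolution_def rnk_def)
  \<comment> \<open>the invariant that makes the next step possible: \<open>X * diff G i\<close> consists of cycles of \<open>F\<close>\<close>
  let ?P = "\<lambda>i X. hom_mat (degs F i) (degs G i) X \<and>
    (case i of 0 \<Rightarrow> X = 1\<^sub>m 1 | Suc j \<Rightarrow> diff F j * X * diff G i = 0\<^sub>m (rnk F j) (rnk G (Suc i)))"
  let ?Q = "\<lambda>i X Y. diff F i * Y = X * diff G i"
  have "\<exists>f. \<forall>i. ?P i (f i) \<and> ?Q i (f i) (f (Suc i))"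
  proof (rule dependent_nat_choice)
    show "\<exists>X. ?P 0 X" using hom_mat_one[of "[0]"] by (simp add: D0)
  next
    fix X i assume X: "?P i X"
    then have HX: "hom_mat (degs F i) (degs G i) X" by simp
    then have XC: "X \<in> carrier_mat (rnk F i) (rnk G i)" by (simp add: hom_mat_def rnk_def)
    have N: "hom_mat (degs F i) (degs G (Suc i)) (X * diff G i)"
      by (rule hom_mat_mult[OF HX resolution_hom_mat[OF G]])
    have "\<exists>Y. hom_mat (degs F (Suc i)) (degs G (Suc i)) Y \<and> diff F i * Y = X * diff G i"
    proof (cases i)
      case (Suc j)
      with X have "diff F j * (X * diff G i) = 0\<^sub>m (rnk F j) (length (degs G (Suc i)))"
        using CF[of j] CG[of i] XC by (simp add: rnk_def)
      from resolution_lift[OF F _ this] N show ?thesis by (simp add: Suc)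
    next
      case 0
      show ?thesis unfolding 0
      proof (rule hom_mat_lift[OF resolution_hom_mat[OF F] N[unfolded 0]])
        fix c assume "c < length (degs G (Suc 0))"
        then have c: "c < rnk G (Suc 0)" by (simp add: rnk_def)
        have X1: "X * diff G 0 = diff G 0" using X CG[of 0] by (simp add: 0 R0)
        have "(diff G 0 *\<^sub>v unit_vec (rnk G (Suc 0)) c) $ 0 \<in> I"
          using G unfolding graded_free_resolution_def by auto
        also have "I = {(diff F 0 *\<^sub>v w) $ 0 | w. w \<in> carrier_vec (rnk F 1)}"
          using F unfolding graded_free_resolution_def by simp
        finally obtain w where w: "w \<in> carrier_vec (rnk F 1)"
          "(diff F 0 *\<^sub>v w) $ 0 = (diff G 0 *\<^sub>v unit_vec (rnk G (Suc 0)) c) $ 0" by auto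
        have "diff F 0 *\<^sub>v w = col (diff G 0) c"
          using w(2) CF[of 0] CG[of 0] c by (intro eq_vecI) (auto simp: R0 mult_unit_vec)
        then show "\<exists>v\<in>carrier_vec (length (degs F (Suc 0))). diff F 0 *\<^sub>v v = col (X * diff G 0) c"
          using w(1) unfolding X1 by (auto simp: rnk_def)
      qed
    qed
    then obtain Y where Y: "hom_mat (degs F (Suc i)) (degs G (Suc i)) Y" "diff F i * Y = X * diff G i"
      by blast
    have "diff F i * Y * diff G (Suc i) = X * (diff G i * diff G (Suc i))"
      unfolding Y(2) using XC CG[of i] CG[of "Suc i"] by (simp add: assoc_mult_mat)
    also have "\<dots> = 0\<^sub>m (rnk F i) (rnk G (Suc (Suc i)))"
      using XC by (simp add: resolution_diff_diff[OF G])
    finally show "\<exists>Y. ?P (Suc i) Y \<and> ?Q i X Y" using Y by auto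
  qed
  then obtain f where f: "\<And>i. ?P i (f i)" "\<And>i. ?Q i (f i) (f (Suc i))" by auto
  have "f 0 = 1\<^sub>m 1" using f(1)[of 0] by simp
  with f show ?thesis by blast
qed

text \<open>
  The usual construction of a homotopy: \<open>\<tau> i h\<close> below is the part of \<open>\<rho> - 1\<close> in homological degree
  \<open>Suc i\<close> that the homotopy \<open>h\<close> in degree \<open>i\<close> leaves over.  It consists of cycles, so it lifts
  through the next differential, and the lift is the homotopy in the next degree.
\<close>

lemma chain_map_homotopic_to_one:
  fixes F :: "('d, ('x, 'k::field) poly_ring) graded_complex"
  assumes F: "graded_free_resolution \<delta> I F"
    and \<rho>0: "\<rho> 0 = 1\<^sub>m 1" and \<rho>: "\<And>i. hom_mat (degs F i) (degs F i) (\<rho> i)"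
    and comm: "\<And>i. diff F i * \<rho> (Suc i) = \<rho> i * diff F i"
  shows "\<exists>h. \<forall>i. h i \<in> carrier_mat (rnk F (Suc i)) (rnk F i) \<and>
     diff F (Suc i) * h (Suc i) = \<rho> (Suc i) - 1\<^sub>m (rnk F (Suc i)) - h i * diff F i"
proof -
  note C = resolution_diff_carrier[OF F] and H = resolution_hom_mat[OF F]
  have R0: "rnk F 0 = 1" using F by (auto simp: graded_free_resolution_def rnk_def)
  have R: "\<rho> i \<in> carrier_mat (rnk F i) (rnk F i)" for i using \<rho> by (simp add: hom_mat_def rnk_def)
  define \<tau> where "\<tau> i h = \<rho> (Suc i) - 1\<^sub>m (rnk F (Suc i)) - h * diff F i" for i h
  let ?P = "\<lambda>i h. hom_mat (degs F (Suc i)) (degs F i) h \<and>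
    diff F i * \<tau> i h = 0\<^sub>m (rnk F i) (rnk F (Suc i))"
  let ?Q = "\<lambda>i h h'. diff F (Suc i) * h' = \<tau> i h"
  have expand: "diff F i * \<tau> i h = (\<rho> i - 1\<^sub>m (rnk F i) - diff F i * h) * diff F i"
    if h: "h \<in> carrier_mat (rnk F (Suc i)) (rnk F i)" for i h
  proof -
    have "diff F i * \<tau> i h = diff F i * \<rho> (Suc i) - diff F i * 1\<^sub>m (rnk F (Suc i)) - diff F i * (h * diff F i)"
      unfolding \<tau>_def
      mult_minus_distrib_mat[OF C minus_carrier_mat[OF one_carrier_mat] mult_carrier_mat[OF h C]]
      mult_minus_distrib_mat[OF C R one_carrier_mat] ..
    also have "\<dots> = \<rho> i * diff F i - 1\<^sub>m (rnk F i) * diff F i - (diff F i * h) * diff F i"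
      unfolding comm assoc_mult_mat[OF C h C, symmetric] using C[of i] by simp
    also have "\<dots> = (\<rho> i - 1\<^sub>m (rnk F i) - diff F i * h) * diff F i"
      unfolding minus_mult_distrib_mat[OF minus_carrier_mat[OF one_carrier_mat] mult_carrier_mat[OF C h] C]
        minus_mult_distrib_mat[OF R one_carrier_mat C] ..
    finally show ?thesis .
  qed
  have "\<exists>f. \<forall>i. ?P i (f i) \<and> ?Q i (f i) (f (Suc i))"
  proof (rule dependent_nat_choice)
    have "diff F 0 * \<tau> 0 (0\<^sub>m (rnk F (Suc 0)) (rnk F 0)) = 0\<^sub>m (rnk F 0) (rnk F (Suc 0))"
      by (subst expand) (use C[of 0] in \<open>simp_all add: \<rho>0 R0 minus_r_inv_mat[of _ 1 1]\<close>)
    then show "\<exists>h. ?P 0 h" using hom_mat_zero by (auto simp: rnk_def)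
  next
    fix h i assume h: "?P i h"
    then have hC: "h \<in> carrier_mat (rnk F (Suc i)) (rnk F i)" by (simp add: hom_mat_def rnk_def)
    have "hom_mat (degs F (Suc i)) (degs F (Suc i)) (\<tau> i h)"
      unfolding \<tau>_def
      by (intro hom_mat_minus \<rho> hom_mat_mult[OF conjunct1[OF h] H]) (simp add: rnk_def hom_mat_one)
    from resolution_lift[OF F this] h obtain h' where
      h': "hom_mat (degs F (Suc (Suc i))) (degs F (Suc i)) h'" "diff F (Suc i) * h' = \<tau> i h"
      by (auto simp: rnk_def)
    then have h'C: "h' \<in> carrier_mat (rnk F (Suc (Suc i))) (rnk F (Suc i))"
      by (simp add: hom_mat_def rnk_def)
    have "\<rho> (Suc i) - 1\<^sub>m (rnk F (Suc i)) - \<tau> i h = h * diff F i"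
      using R[of "Suc i"] hC C[of i] by (intro eq_matI) (auto simp: \<tau>_def)
    then have "diff F (Suc i) * \<tau> (Suc i) h' = h * diff F i * diff F (Suc i)"
      unfolding expand[OF h'C] h'(2) by simp
    also have "\<dots> = 0\<^sub>m (rnk F (Suc i)) (rnk F (Suc (Suc i)))"
      using hC C[of i] C[of "Suc i"] resolution_diff_diff[OF F, of i] by (simp add: assoc_mult_mat)
    finally show "\<exists>h'. ?P (Suc i) h' \<and> ?Q i h h'" using h' by blast
  qed
  then show ?thesis unfolding \<tau>_def by (auto simp: hom_mat_def rnk_def)
qed

lemma const_term_mat_mult:
  fixes A B :: "('x, 'k::field) poly_ring mat"
  assumes "A \<in> carrier_mat n m" "B \<in> carrier_mat m p" "r < n" "c < p"
  shows "const_term ((A * B) $$ (r, c)) = (\<Sum>k<m. const_term (A $$ (r, k)) * const_term (B $$ (k, c)))"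
  using assms by (simp add: scalar_prod_def lessThan_atLeast0 lookup_sum const_term_mult)

text \<open>
  Modulo the irrelevant ideal, a basis element of a resolution \<open>F\<close> that is a cycle (its column
  of the incoming map vanishes) and is never part of a boundary (its row of the other map
  vanishes) represents a nonzero class of Tor.  This class is preserved by the comparison maps
  \<open>F \<rightarrow> G \<rightarrow> F\<close>, whose composite is homotopic to the identity: the homotopy terms have no constant
  term at the diagonal entry of this basis element.  So some basis element of \<open>G\<close> hits it with
  a nonzero constant, which forces equal degrees.
\<close>

theorem degree_in_every_resolution:
  fixes F G :: "('d, ('x, 'k::field) poly_ring) graded_complex"
  assumes F: "graded_free_resolution \<delta> I F" and G: "graded_free_resolution \<delta> I G"
    and c: "c < rnk F (Suc i)"
    and cycle: "\<And>r. r < rnk F i \<Longrightarrow> const_term (diff F i $$ (r, c)) = 0"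
    and no_boundary: "\<And>e. e < rnk F (Suc (Suc i)) \<Longrightarrow> const_term (diff F (Suc i) $$ (c, e)) = 0"
  shows "degs F (Suc i) ! c \<in> set (degs G (Suc i))"
proof -
  note C = resolution_diff_carrier[OF F] and CG = resolution_diff_carrier[OF G]
  obtain \<phi> where \<phi>0: "\<phi> 0 = 1\<^sub>m 1" and \<phi>: "\<And>i. hom_mat (degs F i) (degs G i) (\<phi> i)"
    and \<phi>d: "\<And>i. diff F i * \<phi> (Suc i) = \<phi> i * diff G i"
    using chain_map_exists[OF F G] by blast
  obtain \<psi> where \<psi>0: "\<psi> 0 = 1\<^sub>m 1" and \<psi>: "\<And>i. hom_mat (degs G i) (degs F i) (\<psi> i)"
    and \<psi>d: "\<And>i. diff G i * \<psi> (Suc i) = \<psi> i * diff F i"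
    using chain_map_exists[OF G F] by blast
  have \<phi>C: "\<phi> i \<in> carrier_mat (rnk F i) (rnk G i)" and \<psi>C: "\<psi> i \<in> carrier_mat (rnk G i) (rnk F i)" for i
    using \<phi>[of i] \<psi>[of i] by (simp_all add: hom_mat_def rnk_def)
  define \<rho> where "\<rho> i = \<phi> i * \<psi> i" for i
  have \<rho>C: "\<rho> i \<in> carrier_mat (rnk F i) (rnk F i)" for i
    unfolding \<rho>_def using \<phi>C \<psi>C by (metis mult_carrier_mat)
  have "diff F i * \<rho> (Suc i) = \<rho> i * diff F i" for i
  proof -
    have "diff F i * \<rho> (Suc i) = diff F i * \<phi> (Suc i) * \<psi> (Suc i)"
      unfolding \<rho>_def by (rule assoc_mult_mat[symmetric, OF C \<phi>C \<psi>C])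
    also have "\<dots> = \<phi> i * (diff G i * \<psi> (Suc i))"
      unfolding \<phi>d by (rule assoc_mult_mat[OF \<phi>C CG \<psi>C])
    also have "\<dots> = \<rho> i * diff F i"
      unfolding \<psi>d \<rho>_def by (rule assoc_mult_mat[symmetric, OF \<phi>C \<psi>C C])
    finally show ?thesis .
  qed
  moreover have "\<rho> 0 = 1\<^sub>m 1" by (simp add: \<rho>_def \<phi>0 \<psi>0)
  moreover have "hom_mat (degs F i) (degs F i) (\<rho> i)" for i
    unfolding \<rho>_def by (rule hom_mat_mult[OF \<phi> \<psi>])
  ultimately obtain h where hC: "\<And>i. h i \<in> carrier_mat (rnk F (Suc i)) (rnk F i)"
    and h: "\<And>i. diff F (Suc i) * h (Suc i) = \<rho> (Suc i) - 1\<^sub>m (rnk F (Suc i)) - h i * diff F i"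
    using chain_map_homotopic_to_one[OF F, of \<rho>] by blast
  \<comment> \<open>compare the constant terms of the homotopy formula at the diagonal entry of \<open>c\<close>\<close>
  have "const_term ((diff F (Suc i) * h (Suc i)) $$ (c, c)) = 0"
    by (subst const_term_mat_mult[OF C hC c c]) (simp add: no_boundary)
  moreover have "const_term ((h i * diff F i) $$ (c, c)) = 0"
    by (subst const_term_mat_mult[OF hC C c c]) (simp add: cycle)
  moreover have "(diff F (Suc i) * h (Suc i)) $$ (c, c) = \<rho> (Suc i) $$ (c, c) - 1 - (h i * diff F i) $$ (c, c)"
    unfolding h using c hC[of i] C[of i] \<rho>C[of "Suc i"] by simp
  ultimately have "const_term (\<rho> (Suc i) $$ (c, c)) = 1" by (simp add: lookup_minus)
  then have "(\<Sum>k<rnk G (Suc i). const_term (\<phi> (Suc i) $$ (c, k)) * const_term (\<psi> (Suc i) $$ (k, c))) \<noteq> 0"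
    unfolding \<rho>_def by (subst (asm) const_term_mat_mult[OF \<phi>C \<psi>C c c]) simp
  then obtain k where k: "k < rnk G (Suc i)" "const_term (\<phi> (Suc i) $$ (c, k)) \<noteq> 0"
    by (metis (no_types, lifting) lessThan_iff mult_zero_left sum.neutral)
  then have "\<delta> 0 + degs F (Suc i) ! c = degs G (Suc i) ! k"
    using \<phi>[of "Suc i"] c unfolding hom_mat_def rnk_def by (metis in_keys_iff)
  then have "degs F (Suc i) ! c = degs G (Suc i) ! k" by (simp add: \<delta>_zero)
  with k(1) show ?thesis by (simp add: rnk_def)
qed

end


section \<open>Multigraded resolutions as families of vector spaces\<close>

text \<open>
  In the fine grading a homogeneous vector of degree \<open>u\<close> has the entries \<open>c\<^sub>l x\<^sup>u\<^sup>-\<^sup>d\<close> with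
  \<open>d = E ! l\<close>, so it is given by the scalars \<open>c\<^sub>l\<close>, which vanish unless \<open>E ! l\<close> divides \<open>u\<close>.
  A homogeneous matrix is given in the same way by its column degrees together with a scalar
  vector for each column.  This turns exactness into a statement of linear algebra over the
  field for each degree \<open>u\<close>.
\<close>

definition supported :: "'x mon list \<Rightarrow> 'x mon \<Rightarrow> (nat \<Rightarrow> 'k::zero) \<Rightarrow> bool" where
  "supported E u w \<longleftrightarrow> (\<forall>l. w l \<noteq> 0 \<longrightarrow> l < length E \<and> E ! l \<le> u)"

text \<open>A list entry \<open>(d, b)\<close> stands for the column of degree \<open>d\<close> with scalars \<open>b\<close>, so \<open>comb P\<close> is
  the matrix of scalars acting on scalars.\<close>

definition comb :: "('x mon \<times> (nat \<Rightarrow> 'k::field)) list \<Rightarrow> (nat \<Rightarrow> 'k) \<Rightarrow> nat \<Rightarrow> 'k" where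
  "comb P w = (\<lambda>i. \<Sum>l<length P. w l * snd (P ! l) i)"

text \<open>The kernel of the map given by \<open>P\<close>, in degree \<open>u\<close>.\<close>

definition syz :: "('x mon \<times> (nat \<Rightarrow> 'k::field)) list \<Rightarrow> 'x mon \<Rightarrow> (nat \<Rightarrow> 'k) set" where
  "syz P u = {w. supported (map fst P) u w \<and> comb P w = 0}"

definition generates ::
    "('x mon \<times> (nat \<Rightarrow> 'k::field)) list \<Rightarrow> ('x mon \<Rightarrow> (nat \<Rightarrow> 'k) set) \<Rightarrow> bool" where
  "generates P W \<longleftrightarrow> (\<forall>u. W u = comb P ` {w. supported (map fst P) u w})"

text \<open>The ideal in degree \<open>u\<close>, as a submodule of the free module of rank 1 on a generator of degree
  0; this is why only the index 0 occurs.\<close>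

definition ideal_strand :: "('x, 'k::field) poly_ring set \<Rightarrow> 'x mon \<Rightarrow> (nat \<Rightarrow> 'k) set" where
  "ideal_strand I u = {w. \<forall>i. w i \<noteq> 0 \<longrightarrow> i = 0 \<and> mono_poly u \<in> I}"

definition strand_resolution ::
    "('x, 'k::field) poly_ring set \<Rightarrow> (nat \<Rightarrow> ('x mon \<times> (nat \<Rightarrow> 'k)) list) \<Rightarrow> bool" where
  "strand_resolution I P \<longleftrightarrow>
     generates (P 0) (ideal_strand I) \<and> (\<forall>i. generates (P (Suc i)) (syz (P i)))"

definition poly_mat ::
    "'x mon list \<Rightarrow> ('x mon \<times> (nat \<Rightarrow> 'k::field)) list \<Rightarrow> ('x, 'k) poly_ring mat" where
  "poly_mat E P = mat (length E) (length P)
     (\<lambda>(r, c). Poly_Mapping.single (fst (P ! c) - E ! r) (snd (P ! c) r))"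

definition strand_degs ::
    "(nat \<Rightarrow> ('x mon \<times> (nat \<Rightarrow> 'k::field)) list) \<Rightarrow> nat \<Rightarrow> 'x mon list" where
  "strand_degs P i = (case i of 0 \<Rightarrow> [0] | Suc j \<Rightarrow> map fst (P j))"

text \<open>The degrees are pushed forward along \<open>\<delta>\<close>, so that the same data serve for the fine and for
  the standard grading.\<close>

definition complex_of :: "('x mon \<Rightarrow> 'd) \<Rightarrow> (nat \<Rightarrow> ('x mon \<times> (nat \<Rightarrow> 'k::field)) list) \<Rightarrow>
    ('d, ('x, 'k) poly_ring) graded_complex" where
  "complex_of \<delta> P =
     \<lparr>degs = \<lambda>i. map \<delta> (strand_degs P i), diff = \<lambda>i. poly_mat (strand_degs P i) (P i)\<rparr>"

lemma length_strand_degs: "length (strand_degs P (Suc i)) = length (P i)"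
  by (simp add: strand_degs_def)

lemma rnk_complex_of: "rnk (complex_of \<delta> P) i = length (strand_degs P i)"
  by (simp add: rnk_def complex_of_def)

lemma diff_complex_of_entry:
  assumes "r < rnk (complex_of \<delta> P) i" "c < rnk (complex_of \<delta> P) (Suc i)"
  shows "diff (complex_of \<delta> P) i $$ (r, c) =
    Poly_Mapping.single (fst (P i ! c) - strand_degs P i ! r) (snd (P i ! c) r)"
  using assms unfolding rnk_complex_of length_strand_degs by (simp add: complex_of_def poly_mat_def)

definition coeffs_at ::
    "'x mon list \<Rightarrow> 'x mon \<Rightarrow> ('x, 'k::field) poly_ring vec \<Rightarrow> nat \<Rightarrow> 'k" where
  "coeffs_at E u v =
     (\<lambda>l. if l < length E \<and> E ! l \<le> u then Poly_Mapping.lookup (v $ l) (u - E ! l) else 0)"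

text \<open>\<open>coeffs_at E u v\<close> is the homogeneous component of \<open>v\<close> of degree \<open>u\<close>, in terms of scalars.  A
  vector is determined by these components, all but finitely many of them vanish, and
  multiplication by a homogeneous matrix acts on each of them separately.  So the images and kernels
  of homogeneous matrices can be computed degree by degree.\<close>

lemma lookup_single_mult:
  fixes f :: "('x, 'k::field) poly_ring"
  shows "Poly_Mapping.lookup (Poly_Mapping.single t a * f) s =
    (if t \<le> s then a * Poly_Mapping.lookup f (s - t) else 0)"
proof -
  have "Poly_Mapping.lookup (Poly_Mapping.single t a * f) s =
      a * (\<Sum>q. Poly_Mapping.lookup f q when s = t + q)"
    by (simp add: lookup_mult lookup_single when_mult)
  also have "(\<lambda>q. Poly_Mapping.lookup f q when s = t + q) =
      (\<lambda>q. Poly_Mapping.lookup f q when (s - t = q \<and> t \<le> s))"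
    by (intro ext when_cong refl) (fastforce simp: fun_eq_iff le_fun_def)
  finally show ?thesis by (cases "t \<le> s") simp_all
qed

lemma coeffs_at_mult:
  fixes v :: "('x, 'k::field) poly_ring vec"
  assumes P: "\<And>p. p \<in> set P \<Longrightarrow> supported E (fst p) (snd p)"
    and v: "v \<in> carrier_vec (length P)"
  shows "coeffs_at E u (poly_mat E P *\<^sub>v v) = comb P (coeffs_at (map fst P) u v)"
proof
  fix r
  show "coeffs_at E u (poly_mat E P *\<^sub>v v) r = comb P (coeffs_at (map fst P) u v) r"
  proof (cases "r < length E \<and> E ! r \<le> u")
    case True
    have "coeffs_at E u (poly_mat E P *\<^sub>v v) r =
        (\<Sum>c<length P. Poly_Mapping.lookup
          (Poly_Mapping.single (fst (P ! c) - E ! r) (snd (P ! c) r) * v $ c) (u - E ! r))"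
      using True v
      by (simp add: coeffs_at_def poly_mat_def scalar_prod_def lessThan_atLeast0 lookup_sum)
    also have "\<dots> = comb P (coeffs_at (map fst P) u v) r"
      unfolding comb_def
    proof (intro sum.cong refl)
      fix c assume c: "c \<in> {..<length P}"
      show "Poly_Mapping.lookup
          (Poly_Mapping.single (fst (P ! c) - E ! r) (snd (P ! c) r) * v $ c) (u - E ! r) =
          coeffs_at (map fst P) u v c * snd (P ! c) r"
      proof (cases "snd (P ! c) r = 0")
        case False
        then have d: "E ! r \<le> fst (P ! c)" using P[of "P ! c"] c by (auto simp: supported_def)
        then have "fst (P ! c) - E ! r \<le> u - E ! r \<longleftrightarrow> fst (P ! c) \<le> u"
          using True by (simp add: le_fun_def) (meson diff_le_mono le_diff_iff)
        moreover have "u - E ! r - (fst (P ! c) - E ! r) = u - fst (P ! c)"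
          using d by (simp add: fun_eq_iff le_fun_def)
        ultimately show ?thesis using c by (simp add: lookup_single_mult coeffs_at_def)
      qed simp
    qed
    finally show ?thesis .
  next
    case False
    have "coeffs_at (map fst P) u v c * snd (P ! c) r = 0" if "c < length P" for c
      using P[of "P ! c"] that False by (auto simp: coeffs_at_def supported_def dest: order_trans)
    then have "comb P (coeffs_at (map fst P) u v) r = 0" unfolding comb_def by (intro sum.neutral) blast
    with False show ?thesis by (auto simp: coeffs_at_def)
  qed
qed

lemma coeffs_at_supported: "supported E u (coeffs_at E u v)"
  by (auto simp: supported_def coeffs_at_def split: if_splits)

lemma coeffs_at_inj:
  assumes "v \<in> carrier_vec (length E)" "v' \<in> carrier_vec (length E)"
    and "\<And>u. coeffs_at E u v = coeffs_at E u v'"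
  shows "v = v'"
proof (rule eq_vecI)
  fix l assume "l < dim_vec v'"
  then have l: "l < length E" using assms by simp
  show "v $ l = v' $ l"
  proof (rule poly_mapping_eqI)
    fix t
    have "coeffs_at E (t + E ! l) v l = coeffs_at E (t + E ! l) v' l" by (simp add: assms)
    moreover have "t + E ! l - E ! l = t" "E ! l \<le> t + E ! l" by (auto simp: fun_eq_iff le_fun_def)
    ultimately show "Poly_Mapping.lookup (v $ l) t = Poly_Mapping.lookup (v' $ l) t"
      using l by (simp add: coeffs_at_def)
  qed
qed (use assms in simp)

lemma finite_coeffs_at: "finite {u. coeffs_at E u v \<noteq> 0}"
proof (rule finite_subset)
  show "{u. coeffs_at E u v \<noteq> 0} \<subseteq>
      (\<Union>l<length E. (\<lambda>t. t + E ! l) ` Poly_Mapping.keys (v $ l))"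
  proof
    fix u assume "u \<in> {u. coeffs_at E u v \<noteq> 0}"
    then obtain l where l: "l < length E" "E ! l \<le> u" "u - E ! l \<in> Poly_Mapping.keys (v $ l)"
      by (auto simp: coeffs_at_def fun_eq_iff in_keys_iff split: if_splits)
    moreover have "u = (u - E ! l) + E ! l" using l(2) by (simp add: fun_eq_iff le_fun_def)
    ultimately show "u \<in> (\<Union>l<length E. (\<lambda>t. t + E ! l) ` Poly_Mapping.keys (v $ l))" by blast
  qed
qed simp

lemma coeffs_at_realize:
  fixes w :: "'x mon \<Rightarrow> nat \<Rightarrow> 'k::field"
  assumes "finite U" and w: "\<And>u. u \<in> U \<Longrightarrow> supported E u (w u)"
  obtains v where "v \<in> carrier_vec (length E)"
    "\<And>u. coeffs_at E u v = (if u \<in> U then w u else 0)"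
proof
  define v where "v = vec (length E) (\<lambda>l. \<Sum>u\<in>U. Poly_Mapping.single (u - E ! l) (w u l))"
  show "v \<in> carrier_vec (length E)" by (simp add: v_def)
  fix u
  show "coeffs_at E u v = (if u \<in> U then w u else 0)"
  proof
    fix l
    show "coeffs_at E u v l = (if u \<in> U then w u else 0) l"
    proof (cases "l < length E \<and> E ! l \<le> u")
      case True
      have "coeffs_at E u v l = (\<Sum>u'\<in>U. (w u' l when u' - E ! l = u - E ! l))"
        using True by (simp add: coeffs_at_def v_def lookup_sum lookup_single)
      also have "\<dots> = (\<Sum>u'\<in>U. if u' = u then w u l else 0)"
      proof (intro sum.cong refl)
        fix u' assume u': "u' \<in> U"
        have "u' = u" if "w u' l \<noteq> 0" "u' - E ! l = u - E ! l"
        proof -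
          have "E ! l \<le> u'" using w[OF u'] that by (auto simp: supported_def)
          with that True show ?thesis by (simp add: fun_eq_iff le_fun_def) (metis eq_diff_iff)
        qed
        then show "(w u' l when u' - E ! l = u - E ! l) = (if u' = u then w u l else 0)"
          by (auto simp: when_def)
      qed
      also have "\<dots> = (if u \<in> U then w u else 0) l" using \<open>finite U\<close> by simp
      finally show ?thesis .
    qed (use w in \<open>auto simp: coeffs_at_def supported_def\<close>)
  qed
qed

lemma comb_zero [simp]: "comb P 0 = 0"
  by (simp add: comb_def fun_eq_iff)

lemma supported_zero [simp]: "supported E u 0"
  by (simp add: supported_def)

lemma generates_mem:
  assumes "generates P W" "l < length P"
  shows "snd (P ! l) \<in> W (fst (P ! l))"
proof -
  have "comb P (\<lambda>i. if i = l then 1 else 0) = snd (P ! l)"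
    using assms(2) by (simp add: comb_def if_distrib[of "\<lambda>x. x * _"] cong: if_cong)
  moreover have "supported (map fst P) (fst (P ! l)) (\<lambda>i. if i = l then 1 else (0::'b))"
    using assms(2) by (auto simp: supported_def)
  ultimately show ?thesis using assms(1) unfolding generates_def by (metis image_eqI mem_Collect_eq)
qed

lemma image_poly_mat:
  fixes P :: "('x mon \<times> (nat \<Rightarrow> 'k::field)) list"
  assumes P: "\<And>p. p \<in> set P \<Longrightarrow> supported E (fst p) (snd p)" and W: "generates P W"
  shows "{poly_mat E P *\<^sub>v w | w. w \<in> carrier_vec (length P)} =
    {v \<in> carrier_vec (length E). \<forall>u. coeffs_at E u v \<in> W u}" (is "?L = ?R")
proof
  show "?L \<subseteq> ?R"
  proof
    fix v assume "v \<in> ?L"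
    then obtain w where w: "w \<in> carrier_vec (length P)" "v = poly_mat E P *\<^sub>v w" by blast
    have "v \<in> carrier_vec (length E)" unfolding w(2) by (simp add: poly_mat_def carrier_dim_vec)
    moreover have "coeffs_at E u v \<in> W u" for u
    proof -
      have "coeffs_at E u v = comb P (coeffs_at (map fst P) u w)"
        unfolding w(2) by (rule coeffs_at_mult) (use P w(1) in auto)
      then show ?thesis using W coeffs_at_supported[of "map fst P" u w] unfolding generates_def by blast
    qed
    ultimately show "v \<in> ?R" by blast
  qed
  show "?R \<subseteq> ?L"
  proof
    fix v assume v: "v \<in> ?R"
    have "coeffs_at E u v \<in> comb P ` {w. supported (map fst P) u w}" for u
      using v W by (simp add: generates_def)
    then have "\<forall>u. \<exists>w. supported (map fst P) u w \<and> comb P w = coeffs_at E u v"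
      by (simp add: image_iff) metis
    then obtain w where w: "\<And>u. supported (map fst P) u (w u)" "\<And>u. comb P (w u) = coeffs_at E u v"
      by metis
    obtain z where z: "z \<in> carrier_vec (length (map fst P))"
      "\<And>u. coeffs_at (map fst P) u z = (if u \<in> {u. coeffs_at E u v \<noteq> 0} then w u else 0)"
      using coeffs_at_realize[OF finite_coeffs_at, where E = "map fst P" and w = w] w(1) by blast
    then have zc: "z \<in> carrier_vec (length P)" by simp
    have "poly_mat E P *\<^sub>v z = v"
    proof (rule coeffs_at_inj)
      show "poly_mat E P *\<^sub>v z \<in> carrier_vec (length E)" by (simp add: poly_mat_def carrier_dim_vec)
      show "v \<in> carrier_vec (length E)" using v by simp
      show "coeffs_at E u (poly_mat E P *\<^sub>v z) = coeffs_at E u v" for u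
        by (simp add: coeffs_at_mult[OF P zc] z(2) w(2))
    qed
    with zc show "v \<in> ?L" by blast
  qed
qed

lemma kernel_poly_mat:
  fixes P :: "('x mon \<times> (nat \<Rightarrow> 'k::field)) list"
  assumes P: "\<And>p. p \<in> set P \<Longrightarrow> supported E (fst p) (snd p)"
  shows "mat_kernel (poly_mat E P) =
    {v \<in> carrier_vec (length (map fst P)). \<forall>u. coeffs_at (map fst P) u v \<in> syz P u}"
proof -
  have "poly_mat E P *\<^sub>v v = 0\<^sub>v (length E) \<longleftrightarrow> (\<forall>u. comb P (coeffs_at (map fst P) u v) = 0)"
    if v: "v \<in> carrier_vec (length P)" for v
  proof -
    have z: "coeffs_at E u (0\<^sub>v (length E) :: ('x, 'k) poly_ring vec) = 0" for u
      by (auto simp: coeffs_at_def fun_eq_iff)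
    have "poly_mat E P *\<^sub>v v = 0\<^sub>v (length E)" if "\<And>u. comb P (coeffs_at (map fst P) u v) = 0"
      by (rule coeffs_at_inj[of _ E])
        (simp_all add: coeffs_at_mult[OF P v] that z, simp add: poly_mat_def carrier_dim_vec)
    then show ?thesis by (metis coeffs_at_mult[OF P v] z)
  qed
  then show ?thesis
    using coeffs_at_supported[of "map fst P"] by (auto simp: mat_kernel_def syz_def poly_mat_def)
qed

lemma mem_monomial_ideal:
  fixes f :: "('x, 'k::field) poly_ring"
  assumes I: "I = ideal_gen (mono_poly ` G)"
  shows "f \<in> I \<longleftrightarrow> (\<forall>u \<in> Poly_Mapping.keys f. mono_poly u \<in> I)"
proof
  interpret M: Modules.module "(*) :: ('x, 'k) poly_ring \<Rightarrow> _" by (rule module_poly_ring)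
  show "\<forall>u \<in> Poly_Mapping.keys f. mono_poly u \<in> I" if "f \<in> I"
    using that unfolding I mono_poly_in_ideal_gen_iff by (blast intro: keys_ideal_gen)
  assume f: "\<forall>u \<in> Poly_Mapping.keys f. mono_poly u \<in> I"
  have "f = (\<Sum>u\<in>Poly_Mapping.keys f. Poly_Mapping.single 0 (Poly_Mapping.lookup f u) * mono_poly u)"
    by (rule poly_mapping_eqI)
      (simp add: lookup_sum lookup_single mono_poly_def mult_single when_def in_keys_iff)
  also have "\<dots> \<in> I"
    using f unfolding I ideal_gen_def by (intro M.span_sum M.span_scale) blast
  finally show "f \<in> I" .
qed

lemma strand_resolution_supported:
  assumes P: "strand_resolution I P" and p: "p \<in> set (P i)"
  shows "supported (strand_degs P i) (fst p) (snd p)"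
proof -
  obtain l where l: "l < length (P i)" "p = P i ! l" using p by (metis in_set_conv_nth)
  show ?thesis
  proof (cases i)
    case 0
    with P l generates_mem[of "P 0" "ideal_strand I" l] show ?thesis
      by (auto simp: strand_resolution_def ideal_strand_def supported_def strand_degs_def le_fun_def)
  next
    case (Suc j)
    with P l generates_mem[of "P i" "syz (P j)" l] show ?thesis
      by (auto simp: strand_resolution_def syz_def strand_degs_def)
  qed
qed

text \<open>Exactness may therefore be checked on scalars, separately in each multidegree.\<close>

theorem (in grading) graded_free_resolution_complex_of:
  fixes I :: "('x, 'k::field) poly_ring set"
  assumes I: "I = ideal_gen (mono_poly ` G)" and P: "strand_resolution I P"
  shows "graded_free_resolution \<delta> I (complex_of \<delta> P)"
proof -
  let ?F = "complex_of \<delta> P"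
  note len = length_strand_degs and rnk = rnk_complex_of
  have diff: "diff ?F i = poly_mat (strand_degs P i) (P i)" for i by (simp add: complex_of_def)
  note sup = strand_resolution_supported[OF P]
  have "{(diff ?F 0 *\<^sub>v w) $ 0 | w. w \<in> carrier_vec (rnk ?F 1)} =
      (\<lambda>v. v $ 0) ` {poly_mat [0] (P 0) *\<^sub>v w | w. w \<in> carrier_vec (length (P 0))}"
    by (auto simp: diff rnk len strand_degs_def)
  also have "\<dots> = (\<lambda>v. v $ 0) ` {v \<in> carrier_vec (length [0 :: 'x mon]). \<forall>u. coeffs_at [0] u v \<in> ideal_strand I u}"
    using P sup[of _ 0] by (subst image_poly_mat) (auto simp: strand_resolution_def strand_degs_def)
  also have "\<dots> = (\<lambda>v. v $ 0) ` {v \<in> carrier_vec 1. v $ 0 \<in> I}"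
  proof -
    have "coeffs_at [0] u v \<in> ideal_strand I u \<longleftrightarrow> (u \<in> Poly_Mapping.keys (v $ 0) \<longrightarrow> mono_poly u \<in> I)"
      for u and v :: "('x, 'k) poly_ring vec"
      by (auto simp: coeffs_at_def ideal_strand_def in_keys_iff le_fun_def)
    then have "(\<forall>u. coeffs_at [0] u v \<in> ideal_strand I u) \<longleftrightarrow> v $ 0 \<in> I" for v
      unfolding mem_monomial_ideal[OF I, of "v $ 0"] by blast
    then show ?thesis by simp
  qed
  also have "\<dots> = I"
  proof
    show "I \<subseteq> (\<lambda>v. v $ 0) ` {v \<in> carrier_vec 1. v $ 0 \<in> I}"
      by (rule subsetI, rule_tac x = "vec 1 (\<lambda>_. x)" in image_eqI) simp_all
  qed blast
  finally have im0: "{(diff ?F 0 *\<^sub>v w) $ 0 | w. w \<in> carrier_vec (rnk ?F 1)} = I" .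
  have "{diff ?F (Suc i) *\<^sub>v w | w. w \<in> carrier_vec (rnk ?F (Suc (Suc i)))} = mat_kernel (diff ?F i)" for i
    unfolding diff rnk len
    by (subst image_poly_mat[OF sup, of _ _ "syz (P i)"])
      (use P in \<open>simp_all add: strand_resolution_def kernel_poly_mat[OF sup]\<close>, simp add: strand_degs_def)
  moreover have "\<delta> u + degs ?F i ! r = degs ?F (Suc i) ! c"
    if r: "r < rnk ?F i" and c: "c < rnk ?F (Suc i)" and u: "u \<in> Poly_Mapping.keys (diff ?F i $$ (r, c))"
    for i r c u
  proof -
    have c': "c < length (P i)" using c by (simp add: rnk len)
    have u': "u = fst (P i ! c) - strand_degs P i ! r" "snd (P i ! c) r \<noteq> 0"
      using u r c' by (auto simp: diff poly_mat_def rnk split: if_splits)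
    then have "strand_degs P i ! r \<le> fst (P i ! c)"
      using sup[of "P i ! c"] c' by (auto simp: supported_def)
    then have "u + strand_degs P i ! r = fst (P i ! c)" by (simp add: u' fun_eq_iff le_fun_def)
    moreover have "strand_degs P (Suc i) ! c = fst (P i ! c)" using c' by (simp add: strand_degs_def)
    moreover have "degs ?F (Suc i) ! c = \<delta> (strand_degs P (Suc i) ! c)"
      using c unfolding rnk by (simp add: complex_of_def)
    moreover have "degs ?F i ! r = \<delta> (strand_degs P i ! r)"
      using r unfolding rnk by (simp add: complex_of_def)
    ultimately show ?thesis by (metis \<delta>_add)
  qed
  moreover have "degs ?F 0 = [0]" by (simp add: complex_of_def strand_degs_def \<delta>_zero)
  moreover have "diff ?F i \<in> carrier_mat (rnk ?F i) (rnk ?F (Suc i))" for i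
    by (simp add: diff rnk len poly_mat_def)
  ultimately show ?thesis using im0 unfolding graded_free_resolution_def by blast
qed


section \<open>Existence of a minimal multigraded resolution\<close>

text \<open>The strands are subspaces of the space of all scalar sequences.\<close>

interpretation funvec: vector_space "\<lambda>(c::'k::field) (f::nat \<Rightarrow> 'k) i. c * f i"
  by unfold_locales (auto simp: fun_eq_iff algebra_simps)

lemma sum_fun_apply: "(\<Sum>a\<in>A. f a) i = (\<Sum>a\<in>A. f a i)"
  by (induction A rule: infinite_finite_induct) auto

lemma comb_eq_sum: "comb P w = (\<Sum>l<length P. (\<lambda>i. w l * snd (P ! l) i))"
  by (simp add: comb_def fun_eq_iff sum_fun_apply)

lemma comb_add: "comb P (v + w) = comb P v + comb P w"
  by (simp add: comb_def fun_eq_iff sum.distrib algebra_simps)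

lemma comb_scale: "comb P (\<lambda>i. c * v i) = (\<lambda>i. c * comb P v i)"
  by (simp add: comb_def fun_eq_iff sum_distrib_left mult.assoc)

lemma supported_add:
  fixes v w :: "nat \<Rightarrow> 'k::field"
  shows "supported E u v \<Longrightarrow> supported E u w \<Longrightarrow> supported E u (v + w)"
  unfolding supported_def plus_fun_apply by (metis add_0)

lemma comb_image_eq_span:
  fixes P :: "('x mon \<times> (nat \<Rightarrow> 'k::field)) list"
  shows "comb P ` {w. supported (map fst P) u w} = funvec.span (snd ` {p \<in> set P. fst p \<le> u})"
  (is "?L = ?R")
proof
  show "?L \<subseteq> ?R"
  proof (rule image_subsetI)
    fix w assume w: "w \<in> {w :: nat \<Rightarrow> 'k. supported (map fst P) u w}"
    show "comb P w \<in> ?R"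
      unfolding comb_eq_sum
    proof (intro funvec.span_sum)
      fix l assume l: "l \<in> {..<length P}"
      show "(\<lambda>i. w l * snd (P ! l) i) \<in> ?R"
      proof (cases "w l = 0")
        case True
        have "(\<lambda>i. w l * snd (P ! l) i) = 0" unfolding True by (simp add: fun_eq_iff)
        then show ?thesis by (simp only: funvec.span_zero)
      next
        case False
        with w l have "snd (P ! l) \<in> snd ` {p \<in> set P. fst p \<le> u}" by (auto simp: supported_def)
        then show ?thesis by (rule funvec.span_scale[OF funvec.span_base])
      qed
    qed
  qed
  show "?R \<subseteq> ?L"
  proof (rule funvec.span_minimal)
    show "funvec.subspace ?L"
    proof (rule funvec.subspaceI)
      show "0 \<in> ?L" by (rule image_eqI[of _ _ 0]) simp_all
    next
      fix x y assume "x \<in> ?L" "y \<in> ?L"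
      then obtain v w where "x = comb P v" "y = comb P w" "supported (map fst P) u v"
        "supported (map fst P) u w" by blast
      then show "x + y \<in> ?L"
        by (intro image_eqI[of _ _ "v + w"]) (simp_all add: comb_add supported_add)
    next
      fix c :: 'k and x assume "x \<in> ?L"
      then obtain v where "x = comb P v" "supported (map fst P) u v" by blast
      then show "(\<lambda>i. c * x i) \<in> ?L"
        by (intro image_eqI[of _ _ "\<lambda>i. c * v i"])
          (auto simp: comb_scale supported_def)
    qed
    show "snd ` {p \<in> set P. fst p \<le> u} \<subseteq> ?L"
    proof (rule image_subsetI)
      fix p assume "p \<in> {p \<in> set P. fst p \<le> u}"
      then obtain l where l: "l < length P" "p = P ! l" "fst (P ! l) \<le> u"
        by (auto simp: in_set_conv_nth)
      then have "comb P (\<lambda>i. if i = l then 1 else 0) = snd p"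
        by (simp add: comb_def if_distrib[of "\<lambda>x. x * _"] cong: if_cong)
      then show "snd p \<in> ?L" using l
        by (intro image_eqI[of _ _ "\<lambda>i. if i = l then 1 else 0"]) (auto simp: supported_def)
    qed
  qed
qed

lemma generates_iff_span:
  "generates P W \<longleftrightarrow> (\<forall>u. W u = funvec.span (snd ` {p \<in> set P. fst p \<le> u}))"
  by (simp add: generates_def comb_image_eq_span)

lemma finite_below: "finite {v :: 'x::finite \<Rightarrow> nat. v \<le> e}"
proof -
  have "{v. v \<le> e} = Pi\<^sub>E UNIV (\<lambda>x. {..e x})"
    by (auto simp: le_fun_def PiE_iff)
  then show ?thesis by (simp add: finite_PiE)
qed

lemma subspace_finite_span:
  fixes V :: "(nat \<Rightarrow> 'k::field) set"
  assumes "\<And>f i. f \<in> V \<Longrightarrow> f i \<noteq> 0 \<Longrightarrow> i < n"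
  shows "\<exists>B. finite B \<and> B \<subseteq> V \<and> V \<subseteq> funvec.span B"
proof -
  define T where "T = (\<lambda>j i. if i = j then 1 else 0 :: 'k) ` {..<n}"
  obtain B where B: "B \<subseteq> V" "funvec.independent B" "V \<subseteq> funvec.span B"
    using funvec.maximal_independent_subset by blast
  have "f \<in> funvec.span T" if "f \<in> V" for f
  proof -
    have "f = (\<Sum>j<n. (\<lambda>i. f j * (if i = j then 1 else 0)))"
      using assms[OF that] by (auto simp: fun_eq_iff sum_fun_apply if_distrib cong: if_cong)
    also have "\<dots> \<in> funvec.span T"
      by (intro funvec.span_sum funvec.span_scale funvec.span_base) (auto simp: T_def)
    finally show ?thesis .
  qed
  then have "finite B"
    using funvec.independent_span_bound[of T B] B by (auto simp: T_def)
  with B show ?thesis by blast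
qed

text \<open>
  A multigraded submodule \<open>W\<close> of a free module has a finite homogeneous generating set as soon
  as all of its elements are multiples of elements in degrees dividing a fixed monomial \<open>e\<close>, since
  there are finitely many such degrees and each strand is finite-dimensional.  In a generating
  set of least size no relation can have a nonzero constant coefficient, because such a relation
  would express one generator by the others.
\<close>

lemma minimal_generators_exist:
  fixes W :: "'x::finite mon \<Rightarrow> (nat \<Rightarrow> 'k::field) set"
  assumes sub: "\<And>u. funvec.subspace (W u)"
    and mono: "\<And>u v. u \<le> v \<Longrightarrow> W u \<subseteq> W v"
    and top: "\<And>u. W u \<subseteq> W (inf u e)"
    and sup: "\<And>u w. w \<in> W u \<Longrightarrow> supported E u w"
  shows "\<exists>P. generates P W \<and> (\<forall>p \<in> set P. fst p \<le> e) \<and>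
    (\<forall>u. \<forall>w \<in> syz P u. \<forall>l < length P. w l \<noteq> 0 \<longrightarrow> fst (P ! l) \<noteq> u)"
proof -
  define good where "good S \<longleftrightarrow> finite S \<and> (\<forall>p\<in>S. fst p \<le> e) \<and>
    (\<forall>u. W u = funvec.span (snd ` {p \<in> S. fst p \<le> u}))" for S :: "('x mon \<times> (nat \<Rightarrow> 'k)) set"
  have "\<exists>B. finite B \<and> B \<subseteq> W u \<and> W u \<subseteq> funvec.span B" for u
    by (rule subspace_finite_span[of _ "length E"]) (use sup in \<open>auto simp: supported_def\<close>)
  then obtain B where B: "\<And>u. finite (B u)" "\<And>u. B u \<subseteq> W u" "\<And>u. W u \<subseteq> funvec.span (B u)"
    by metis
  define S0 where "S0 = (\<Union>v\<in>{v. v \<le> e}. Pair v ` B v)"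
  have "good S0"
    unfolding good_def
  proof (intro conjI allI)
    show "finite S0" using B(1) by (auto simp: S0_def intro: finite_below)
    show "\<forall>p\<in>S0. fst p \<le> e" by (auto simp: S0_def)
    fix u
    show "W u = funvec.span (snd ` {p \<in> S0. fst p \<le> u})"
    proof
      have "W u \<subseteq> funvec.span (B (inf u e))" using top B(3) by blast
      also have "\<dots> \<subseteq> funvec.span (snd ` {p \<in> S0. fst p \<le> u})"
      proof (rule funvec.span_mono, rule subsetI)
        fix b assume "b \<in> B (inf u e)"
        then have "(inf u e, b) \<in> {p \<in> S0. fst p \<le> u}"
          unfolding S0_def by (simp add: image_iff)
        then show "b \<in> snd ` {p \<in> S0. fst p \<le> u}" by force
      qed
      finally show "W u \<subseteq> funvec.span (snd ` {p \<in> S0. fst p \<le> u})" .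
      show "funvec.span (snd ` {p \<in> S0. fst p \<le> u}) \<subseteq> W u"
        using B(2) mono by (intro funvec.span_minimal sub) (fastforce simp: S0_def)
    qed
  qed
  then obtain S where S: "good S" and least: "\<And>S'. good S' \<Longrightarrow> card S \<le> card S'"
    using ex_has_least_nat[of good S0 card] by blast
  have "finite S" using S by (simp add: good_def)
  then obtain P where P: "set P = S" "distinct P" using finite_distinct_list by blast
  have "generates P W" using S by (simp add: generates_iff_span good_def P(1))
  moreover have "fst (P ! l) \<noteq> u" if w: "w \<in> syz P u" and l: "l < length P" "w l \<noteq> 0" for w u l
  proof
    assume u: "fst (P ! l) = u"
    define q where "q = P ! l"
    let ?T = "\<lambda>u. snd ` {p \<in> S - {q}. fst p \<le> u}"
    have "(\<Sum>j<length P. (\<lambda>i. w j * snd (P ! j) i)) = 0"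
      using w by (simp add: syz_def comb_eq_sum)
    then have "(\<lambda>i. w l * snd q i) + (\<Sum>j\<in>{..<length P} - {l}. (\<lambda>i. w j * snd (P ! j) i)) = 0"
      using l by (simp add: sum.remove q_def)
    then have eq: "(\<lambda>i. w l * snd q i) = - (\<Sum>j\<in>{..<length P} - {l}. (\<lambda>i. w j * snd (P ! j) i))"
      by (simp add: add_eq_0_iff2)
    have "(\<lambda>i. w j * snd (P ! j) i) \<in> funvec.span (?T u)" if j: "j \<in> {..<length P} - {l}" for j
    proof (cases "w j = 0")
      case True
      have "(\<lambda>i. w j * snd (P ! j) i) = 0" unfolding True by (simp add: fun_eq_iff)
      then show ?thesis by (simp only: funvec.span_zero)
    next
      case False
      have "P ! j \<in> S - {q}" using j l P by (auto simp: q_def nth_eq_iff_index_eq)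
      moreover have "fst (P ! j) \<le> u" using w False j by (auto simp: syz_def supported_def)
      ultimately have "snd (P ! j) \<in> ?T u" by blast
      then show ?thesis by (rule funvec.span_scale[OF funvec.span_base])
    qed
    then have "(\<lambda>i. w l * snd q i) \<in> funvec.span (?T u)"
      unfolding eq by (intro funvec.span_neg funvec.span_sum)
    then have "(\<lambda>i. inverse (w l) * (w l * snd q i)) \<in> funvec.span (?T u)"
      by (rule funvec.span_scale)
    then have q: "snd q \<in> funvec.span (?T u)"
      using l(2) by (simp add: mult.assoc[symmetric])
    have "good (S - {q})"
      unfolding good_def
    proof (intro conjI allI)
      show "finite (S - {q})" "\<forall>p\<in>S - {q}. fst p \<le> e" using S by (auto simp: good_def)
      fix u'
      have "funvec.span (snd ` {p \<in> S. fst p \<le> u'}) \<subseteq> funvec.span (?T u')"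
      proof (intro funvec.span_minimal funvec.subspace_span image_subsetI)
        fix p assume p: "p \<in> {p \<in> S. fst p \<le> u'}"
        show "snd p \<in> funvec.span (?T u')"
        proof (cases "p = q")
          case True
          then have "?T u \<subseteq> ?T u'" using p u q_def by (auto intro: order_trans)
          then show ?thesis using q True funvec.span_mono by blast
        qed (use p in \<open>auto intro: funvec.span_base\<close>)
      qed
      moreover have "funvec.span (?T u') \<subseteq> funvec.span (snd ` {p \<in> S. fst p \<le> u'})"
        by (intro funvec.span_mono) auto
      ultimately show "W u' = funvec.span (?T u')" using S by (auto simp: good_def)
    qed
    then have "card S \<le> card (S - {q})" by (rule least)
    moreover have "q \<in> S" "finite S" using l P S by (auto simp: q_def good_def)
    ultimately show False using card_Diff1_less by (metis not_le)
  qed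
  ultimately show ?thesis using S P by (auto simp: good_def)
qed

text \<open>The bound \<open>e\<close> on degrees passes to syzygies: whether the degree of a generator divides \<open>u\<close>
  depends only on \<open>inf u e\<close>, so the relations in these two degrees are the same.\<close>

lemma minimal_syzygies_exist:
  fixes P :: "('x::finite mon \<times> (nat \<Rightarrow> 'k::field)) list"
  assumes P: "\<forall>p \<in> set P. fst p \<le> e"
  shows "\<exists>Q. generates Q (syz P) \<and> (\<forall>q \<in> set Q. fst q \<le> e) \<and>
    (\<forall>u. \<forall>w \<in> syz Q u. \<forall>l < length Q. w l \<noteq> 0 \<longrightarrow> fst (Q ! l) \<noteq> u)"
proof (rule minimal_generators_exist)
  fix u v :: "'x mon" and w :: "nat \<Rightarrow> 'k"
  show "funvec.subspace (syz P u)"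
  proof (rule funvec.subspaceI)
    fix x y assume "x \<in> syz P u" "y \<in> syz P u"
    then show "x + y \<in> syz P u"
      by (simp add: syz_def comb_add supported_add)
  next
    fix c and x assume "x \<in> syz P u"
    then show "(\<lambda>i. c * x i) \<in> syz P u" by (auto simp: syz_def comb_scale supported_def fun_eq_iff)
  qed (simp add: syz_def)
  show "syz P u \<subseteq> syz P v" if "u \<le> v"
    using that by (auto simp: syz_def supported_def intro: order_trans)
  show "syz P u \<subseteq> syz P (inf u e)"
    using P by (auto simp: syz_def supported_def)
  show "supported (map fst P) u w" if "w \<in> syz P u" using that by (simp add: syz_def)
qed

lemma minimal_ideal_generators_exist:
  fixes I :: "('x::finite, 'k::field) poly_ring set"
  assumes I: "squarefree_monomial_ideal I"
  shows "\<exists>Q. generates Q (ideal_strand I) \<and> (\<forall>q \<in> set Q. fst q \<le> (\<lambda>_. 1)) \<and>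
    (\<forall>u. \<forall>w \<in> syz Q u. \<forall>l < length Q. w l \<noteq> 0 \<longrightarrow> fst (Q ! l) \<noteq> u)"
proof (rule minimal_generators_exist)
  obtain G where G: "\<forall>g\<in>G. squarefree_mon g" "I = ideal_gen (mono_poly ` G)"
    using I by (auto simp: squarefree_monomial_ideal_def)
  fix u v :: "'x mon" and w :: "nat \<Rightarrow> 'k"
  show "funvec.subspace (ideal_strand I u)"
  proof (rule funvec.subspaceI)
    fix x y assume "x \<in> ideal_strand I u" "y \<in> ideal_strand I u"
    then show "x + y \<in> ideal_strand I u"
      unfolding ideal_strand_def mem_Collect_eq plus_fun_apply by (metis add_0)
  qed (auto simp: ideal_strand_def)
  show "ideal_strand I u \<subseteq> ideal_strand I v" if "u \<le> v"
    using that unfolding ideal_strand_def G mono_poly_in_ideal_gen_iff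
    by (auto intro: order_trans)
  show "ideal_strand I u \<subseteq> ideal_strand I (inf u (\<lambda>_. 1))"
    using G(1) unfolding ideal_strand_def G(2) mono_poly_in_ideal_gen_iff
    by (fastforce simp: squarefree_mon_def le_fun_def)
  show "supported [0] u w" if "w \<in> ideal_strand I u"
    using that by (auto simp: ideal_strand_def supported_def le_fun_def)
qed

text \<open>
  Choosing minimal generators of the successive syzygies gives a minimal resolution: a nonzero
  scalar entry between equal degrees would be a relation with a nonzero constant coefficient.  All of
  its multidegrees are squarefree, as the bound \<open>(1, \<dots>, 1)\<close> persists.
\<close>

theorem minimal_resolution_exists:
  fixes I :: "('x::finite, 'k::field) poly_ring set" and \<delta> :: "'x mon \<Rightarrow> 'd::comm_monoid_add"
  assumes \<delta>: "grading \<delta>" and I: "squarefree_monomial_ideal I" and proper: "mono_poly 0 \<notin> I"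
  shows "\<exists>F. minimal_graded_free_resolution \<delta> I F \<and>
    (\<forall>i. \<forall>d \<in> set (degs F i). \<exists>u \<le> (\<lambda>_. 1). d = \<delta> u)"
proof -
  obtain G where G: "I = ideal_gen (mono_poly ` G)"
    using I by (auto simp: squarefree_monomial_ideal_def)
  let ?M = "\<lambda>P :: ('x mon \<times> (nat \<Rightarrow> 'k)) list. (\<forall>p \<in> set P. fst p \<le> (\<lambda>_. 1)) \<and>
    (\<forall>u. \<forall>w \<in> syz P u. \<forall>l < length P. w l \<noteq> 0 \<longrightarrow> fst (P ! l) \<noteq> u)"
  let ?Z = "\<lambda>i P. i = (0::nat) \<longrightarrow> generates P (ideal_strand I)"
  have "\<exists>P. \<forall>i. (?M (P i) \<and> ?Z i (P i)) \<and> generates (P (Suc i)) (syz (P i))"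
  proof (rule dependent_nat_choice)
    show "\<exists>P. ?M P \<and> ?Z 0 P" using minimal_ideal_generators_exist[OF I] by blast
  next
    fix P and i :: nat assume "?M P \<and> ?Z i P"
    then show "\<exists>Q. (?M Q \<and> ?Z (Suc i) Q) \<and> generates Q (syz P)"
      using minimal_syzygies_exist[of P "\<lambda>_. 1"] by blast
  qed
  then obtain P where all: "\<forall>i. (?M (P i) \<and> ?Z i (P i)) \<and> generates (P (Suc i)) (syz (P i))" ..
  have M: "?M (P i)" for i by (rule conjunct1[OF conjunct1[OF spec[OF all]]])
  have P0: "generates (P 0) (ideal_strand I)"
    using conjunct2[OF conjunct1[OF spec[OF all, of 0]]] by simp
  have PS: "generates (P (Suc i)) (syz (P i))" for i by (rule conjunct2[OF spec[OF all]])
  have P: "strand_resolution I P" using P0 PS by (simp add: strand_resolution_def)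
  let ?F = "complex_of \<delta> P"
  have "diff ?F i $$ (r, c) \<in> irrelevant_ideal" if rc: "r < rnk ?F i" "c < rnk ?F (Suc i)" for i r c
    unfolding diff_complex_of_entry[OF rc]
  proof (cases "snd (P i ! c) r = 0")
    case True
    then show "Poly_Mapping.single (fst (P i ! c) - strand_degs P i ! r) (snd (P i ! c) r) \<in> irrelevant_ideal"
      by (simp add: zero_irrelevant)
  next
    case False
    have c: "c < length (P i)" using rc unfolding rnk_complex_of length_strand_degs by simp
    have le: "strand_degs P i ! r \<le> fst (P i ! c)"
      using strand_resolution_supported[OF P, of "P i ! c" i] c False by (auto simp: supported_def)
    have "strand_degs P i ! r \<noteq> fst (P i ! c)"
    proof (cases i)
      case 0
      have "snd (P 0 ! c) \<in> ideal_strand I (fst (P 0 ! c))"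
        using generates_mem[OF P0] c 0 by simp
      with False 0 have "r = 0" "mono_poly (fst (P 0 ! c)) \<in> I" by (auto simp: ideal_strand_def)
      with proper 0 show ?thesis by (auto simp: strand_degs_def)
    next
      case (Suc j)
      have "snd (P i ! c) \<in> syz (P j) (fst (P i ! c))"
        using generates_mem[OF PS] c Suc by simp
      moreover have "r < length (P j)"
        using rc unfolding rnk_complex_of Suc length_strand_degs by simp
      ultimately show ?thesis using M[of j] False by (auto simp: strand_degs_def Suc)
    qed
    with le have "fst (P i ! c) - strand_degs P i ! r \<noteq> 0"
      by (auto simp: fun_eq_iff le_fun_def) (metis le_antisym)
    then show "Poly_Mapping.single (fst (P i ! c) - strand_degs P i ! r) (snd (P i ! c) r) \<in> irrelevant_ideal"
      by (rule single_irrelevant)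
  qed
  moreover have "\<exists>u \<le> (\<lambda>_. 1). d = \<delta> u" if "d \<in> set (degs ?F i)" for d i
  proof (cases i)
    case 0
    with that show ?thesis by (intro exI[of _ 0]) (auto simp: complex_of_def strand_degs_def le_fun_def)
  next
    case (Suc j)
    with that obtain p where "p \<in> set (P j)" "d = \<delta> (fst p)"
      by (auto simp: complex_of_def strand_degs_def)
    then show ?thesis using conjunct1[OF M[of j]] by blast
  qed
  ultimately show ?thesis
    using grading.graded_free_resolution_complex_of[OF \<delta> G P]
    unfolding minimal_graded_free_resolution_def by blast
qed


section \<open>The Lyubeznik resolution\<close>

lemma sum_antisymmetric:
  fixes f :: "nat \<Rightarrow> nat \<Rightarrow> 'k::ab_group_add"
  assumes "finite D" and anti: "\<And>x y. x \<in> D \<Longrightarrow> y \<in> D \<Longrightarrow> x < y \<Longrightarrow> f y x = - f x y"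
  shows "(\<Sum>x\<in>D. \<Sum>y\<in>D - {x}. f x y) = 0"
proof -
  have "(\<Sum>y\<in>D - {x}. f x y) =
      (\<Sum>y\<in>D. if x < y then f x y else 0) + (\<Sum>y\<in>D. if y < x then f x y else 0)"
    if "x \<in> D" for x
  proof -
    have "(\<Sum>y\<in>D - {x}. f x y) = (\<Sum>y\<in>D - {x}. (if x < y then f x y else 0) + (if y < x then f x y else 0))"
      by (intro sum.cong) auto
    also have "\<dots> = (\<Sum>y\<in>D. (if x < y then f x y else 0) + (if y < x then f x y else 0))"
      using \<open>finite D\<close> by (intro sum.mono_neutral_left) auto
    finally show ?thesis by (simp add: sum.distrib)
  qed
  then have "(\<Sum>x\<in>D. \<Sum>y\<in>D - {x}. f x y) =
      (\<Sum>x\<in>D. \<Sum>y\<in>D. if x < y then f x y else 0) + (\<Sum>x\<in>D. \<Sum>y\<in>D. if y < x then f x y else 0)"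
    by (simp add: sum.distrib)
  also have "(\<Sum>x\<in>D. \<Sum>y\<in>D. if y < x then f x y else 0) = (\<Sum>y\<in>D. \<Sum>x\<in>D. if y < x then f x y else 0)"
    by (rule sum.swap)
  also have "\<dots> = - (\<Sum>x\<in>D. \<Sum>y\<in>D. if x < y then f x y else 0)"
    unfolding sum_negf[symmetric] by (intro sum.cong refl) (auto simp: anti)
  finally show ?thesis by simp
qed

text \<open>\<open>face_sign x B\<close> is the coefficient of the face \<open>B\<close> in the boundary of \<open>insert x B\<close>.\<close>

definition face_sign :: "nat \<Rightarrow> nat set \<Rightarrow> 'k::field" where
  "face_sign x B = (-1) ^ card {y \<in> B. y < x}"

definition boundary :: "nat \<Rightarrow> (nat set \<Rightarrow> 'k::field) \<Rightarrow> nat set \<Rightarrow> 'k" where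
  "boundary N \<omega> B = (\<Sum>x\<in>{..<N} - B. face_sign x B * \<omega> (insert x B))"

lemma face_sign_insert:
  assumes "x \<noteq> y" "x \<notin> B"
  shows "face_sign y (insert x B) = (if x < y then - face_sign y B else face_sign y B)"
proof (cases "x < y")
  case True
  then have "{z \<in> insert x B. z < y} = insert x {z \<in> B. z < y}" by auto
  moreover have "finite {z \<in> B. z < y}" by (rule finite_subset[of _ "{..<y}"]) auto
  ultimately show ?thesis using True assms by (simp add: face_sign_def)
next
  case False
  then have "{z \<in> insert x B. z < y} = {z \<in> B. z < y}" by auto
  then show ?thesis using False by (simp add: face_sign_def)
qed

text \<open>The terms obtained by adding \<open>x\<close> and \<open>y\<close> in the two possible orders cancel.\<close>

lemma boundary_boundary: "boundary N (boundary N \<omega>) B = 0"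
proof -
  have "boundary N (boundary N \<omega>) B = (\<Sum>x\<in>{..<N} - B. \<Sum>y\<in>({..<N} - B) - {x}.
      face_sign x B * (face_sign y (insert x B) * \<omega> (insert y (insert x B))))"
    unfolding boundary_def sum_distrib_left by (intro sum.cong refl) auto
  also have "\<dots> = 0"
    by (rule sum_antisymmetric) (auto simp: face_sign_insert insert_commute)
  finally show ?thesis .
qed

text \<open>
  The cone with apex \<open>q\<close> as a contracting homotopy.  As \<open>q\<close> is the least vertex, it always enters
  with sign 1, and adding it to a face reverses the signs of all other vertices.
\<close>

lemma boundary_cone:
  assumes q: "q < N" and above: "\<And>B y. \<omega> B \<noteq> 0 \<Longrightarrow> y \<in> B \<Longrightarrow> q \<le> y"
    and cycle: "\<And>B. boundary N \<omega> B = 0"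
  shows "boundary N (\<lambda>C. if q \<in> C then \<omega> (C - {q}) else 0) B = \<omega> B"
proof (cases "q \<in> B")
  case False
  have "boundary N (\<lambda>C. if q \<in> C then \<omega> (C - {q}) else 0) B =
      (\<Sum>x\<in>{..<N} - B. if x = q then face_sign q B * \<omega> B else 0)"
    unfolding boundary_def using False by (intro sum.cong refl) auto
  also have "\<dots> = face_sign q B * \<omega> B" using False q by simp
  also have "\<dots> = \<omega> B"
  proof (cases "\<omega> B = 0")
    case False
    then have "{y \<in> B. y < q} = {}" using above[of B] by (auto simp: not_less)
    then show ?thesis by (simp only: face_sign_def) simp
  qed simp
  finally show ?thesis .
next
  case True
  define A where "A = B - {q}"
  have B: "B = insert q A" "q \<notin> A" using True by (auto simp: A_def)
  have "{..<N} - A = insert q ({..<N} - B)" using B q by auto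
  with cycle[of A] have "0 = (\<Sum>x\<in>insert q ({..<N} - B). face_sign x A * \<omega> (insert x A))"
    by (simp only: boundary_def)
  also have "\<dots> = face_sign q A * \<omega> B + (\<Sum>x\<in>{..<N} - B. face_sign x A * \<omega> (insert x A))"
    using True by (subst sum.insert) (simp_all add: B(1)[symmetric])
  finally have "0 = face_sign q A * \<omega> B + (\<Sum>x\<in>{..<N} - B. face_sign x A * \<omega> (insert x A))" .
  moreover have "face_sign q A * \<omega> B = \<omega> B"
  proof (cases "\<omega> B = 0")
    case False
    then have "{y \<in> A. y < q} = {}" using above[of B] by (auto simp: not_less A_def)
    then show ?thesis by (simp only: face_sign_def) simp
  qed simp
  ultimately have "\<omega> B = (\<Sum>x\<in>{..<N} - B. - (face_sign x A * \<omega> (insert x A)))"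
    unfolding sum_negf by (metis eq_neg_iff_add_eq_0)
  also have "\<dots> = boundary N (\<lambda>C. if q \<in> C then \<omega> (C - {q}) else 0) B"
    unfolding boundary_def
  proof (intro sum.cong refl)
    fix x assume x: "x \<in> {..<N} - B"
    have C: "insert x B - {q} = insert x A" "q \<in> insert x B" using x B by auto
    show "- (face_sign x A * \<omega> (insert x A)) =
        face_sign x B * (if q \<in> insert x B then \<omega> (insert x B - {q}) else 0)"
    proof (cases "\<omega> (insert x A) = 0")
      case False
      then have "q < x" using above[of "insert x A" x] x B by auto
      then show ?thesis unfolding C(1) using C(2) x B by (simp add: face_sign_insert)
    qed (use C in simp)
  qed
  finally show ?thesis ..
qed

lemma lcm_mon_apply_le_iff:
  assumes "finite A"
  shows "lcm_mon A x \<le> k \<longleftrightarrow> (\<forall>m\<in>A. m x \<le> k)"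
proof (cases "A = {}")
  case False
  with assms show ?thesis
    unfolding lcm_mon_def Sup_nat_def by (subst if_not_P, simp, subst Max_le_iff) simp_all
qed (simp add: lcm_mon_def)

lemma lcm_mon_le_iff: "finite A \<Longrightarrow> lcm_mon A \<le> u \<longleftrightarrow> (\<forall>m\<in>A. m \<le> u)"
  by (simp add: le_fun_def lcm_mon_apply_le_iff) blast

lemma lcm_mon_upper: "finite A \<Longrightarrow> m \<in> A \<Longrightarrow> m \<le> lcm_mon A"
  using lcm_mon_le_iff[of A "lcm_mon A"] by simp

text \<open>
  Generators are referred to by their positions in the list \<open>gs\<close>, so that the order of the list
  is the order of the positions.  A set is rooted if each of its final segments starts with the
  first generator that divides the least common multiple of the segment.  These sets are the faces
  of the Lyubeznik simplicial complex.
\<close>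

locale generator_list =
  fixes gs :: "'x mon list"
begin

definition lcm_at :: "nat set \<Rightarrow> 'x mon" where
  "lcm_at B = lcm_mon ((!) gs ` B)"

definition rooted :: "nat set \<Rightarrow> bool" where
  "rooted B \<longleftrightarrow> B \<subseteq> {..<length gs} \<and> (\<forall>b\<in>B. \<forall>q<b. \<not> gs ! q \<le> lcm_at {y \<in> B. b \<le> y})"

definition faces :: "nat \<Rightarrow> nat set set" where
  "faces k = {B. rooted B \<and> card B = k}"

definition face_list :: "nat \<Rightarrow> nat set list" where
  "face_list k = (SOME l. set l = faces k \<and> distinct l)"

text \<open>In homological degree \<open>Suc i\<close> the basis consists of the rooted sets with \<open>Suc i\<close> elements, and
  the scalars of a basis element are its simplicial boundary.\<close>

definition lyubeznik :: "nat \<Rightarrow> ('x mon \<times> (nat \<Rightarrow> 'k::field)) list" where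
  "lyubeznik i = map (\<lambda>C. (lcm_at C, \<lambda>r. if r < length (face_list i) \<and> face_list i ! r \<subseteq> C
     then face_sign (the_elem (C - face_list i ! r)) (face_list i ! r) else 0)) (face_list (Suc i))"

lemma rooted_finite: "rooted B \<Longrightarrow> finite B"
  by (auto simp: rooted_def intro: finite_subset)

lemma lcm_at_le_iff: "finite B \<Longrightarrow> lcm_at B \<le> u \<longleftrightarrow> (\<forall>b\<in>B. gs ! b \<le> u)"
  by (simp add: lcm_at_def lcm_mon_le_iff)

lemma lcm_at_mono: "finite B \<Longrightarrow> A \<subseteq> B \<Longrightarrow> lcm_at A \<le> lcm_at B"
  using lcm_at_le_iff[of B "lcm_at B"] lcm_at_le_iff[of A "lcm_at B"] finite_subset by blast

lemma rooted_subset: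
  assumes B: "rooted B" and A: "A \<subseteq> B"
  shows "rooted A"
  unfolding rooted_def
proof (intro conjI ballI allI impI)
  show "A \<subseteq> {..<length gs}" using assms by (auto simp: rooted_def)
  fix b q assume b: "b \<in> A" "q < b"
  have "lcm_at {y \<in> A. b \<le> y} \<le> lcm_at {y \<in> B. b \<le> y}"
    using A rooted_finite[OF B] by (intro lcm_at_mono) auto
  moreover have "\<not> gs ! q \<le> lcm_at {y \<in> B. b \<le> y}" using B A b by (auto simp: rooted_def)
  ultimately show "\<not> gs ! q \<le> lcm_at {y \<in> A. b \<le> y}" using order_trans by blast
qed

lemma face_list: "set (face_list k) = faces k" "distinct (face_list k)"
proof -
  have "faces k \<subseteq> Pow {..<length gs}" by (auto simp: faces_def rooted_def)
  then have "finite (faces k)" by (rule finite_subset) simp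
  then have "\<exists>l. set l = faces k \<and> distinct l" by (rule finite_distinct_list)
  from someI_ex[OF this] show "set (face_list k) = faces k" "distinct (face_list k)"
    by (simp_all add: face_list_def)
qed

lemma faces_0: "faces 0 = {{}}"
  using rooted_finite by (auto simp: faces_def rooted_def)

lemma face_list_0: "face_list 0 = [{}]"
proof -
  have "length (face_list 0) = 1"
    using face_list[of 0] distinct_card[of "face_list 0"] by (simp add: faces_0)
  then obtain B where "face_list 0 = [B]" by (auto simp: length_Suc_conv)
  then show ?thesis using face_list(1)[of 0] by (simp add: faces_0)
qed

lemma length_lyubeznik [simp]: "length (lyubeznik i) = length (face_list (Suc i))"
  by (simp add: lyubeznik_def)

lemma map_fst_lyubeznik: "map fst (lyubeznik i) = map lcm_at (face_list (Suc i))"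
  by (simp add: lyubeznik_def)

lemma snd_lyubeznik:
  "l < length (face_list (Suc i)) \<Longrightarrow> snd (lyubeznik i ! l) r =
    (if r < length (face_list i) \<and> face_list i ! r \<subseteq> face_list (Suc i) ! l
     then face_sign (the_elem (face_list (Suc i) ! l - face_list i ! r)) (face_list i ! r) else 0)"
  by (simp add: lyubeznik_def)

text \<open>The chain with coordinates \<open>w\<close>, extended by zero to all sets.\<close>

definition chain_of :: "nat \<Rightarrow> (nat \<Rightarrow> 'k::field) \<Rightarrow> nat set \<Rightarrow> 'k" where
  "chain_of k w C = (\<Sum>l<length (face_list k). if face_list k ! l = C then w l else 0)"

lemma face_list_nth: "l < length (face_list k) \<Longrightarrow> rooted (face_list k ! l) \<and> card (face_list k ! l) = k"
  using face_list(1)[of k] nth_mem[of l "face_list k"] by (auto simp: faces_def)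

lemma chain_of_face_list: "l < length (face_list k) \<Longrightarrow> chain_of k w (face_list k ! l) = w l"
  using face_list(2)[of k] by (simp add: chain_of_def nth_eq_iff_index_eq)

lemma chain_of_nonzero:
  assumes "chain_of k w C \<noteq> 0"
  obtains l where "l < length (face_list k)" "C = face_list k ! l" "w l \<noteq> 0"
proof -
  obtain l where l: "l < length (face_list k)" "(if face_list k ! l = C then w l else 0) \<noteq> 0"
    using assms unfolding chain_of_def by (rule sum.not_neutral_contains_not_neutral) simp
  then show ?thesis using that[of l] by (auto split: if_splits)
qed

lemma chain_of_coords:
  assumes "\<And>C. v C \<noteq> 0 \<Longrightarrow> C \<in> faces k"
  shows "chain_of k (\<lambda>l. if l < length (face_list k) then v (face_list k ! l) else 0) = v"
proof
  fix C
  show "chain_of k (\<lambda>l. if l < length (face_list k) then v (face_list k ! l) else 0) C = v C"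
  proof (cases "C \<in> faces k")
    case True
    then obtain l where "l < length (face_list k)" "C = face_list k ! l"
      using face_list(1)[of k] by (metis in_set_conv_nth)
    then show ?thesis by (simp add: chain_of_face_list)
  next
    case False
    then have "v C = 0" using assms by blast
    moreover have "chain_of k w C = 0" for w :: "nat \<Rightarrow> 'a"
    proof (rule ccontr)
      assume "chain_of k w C \<noteq> 0"
      then obtain l where "l < length (face_list k)" "C = face_list k ! l" by (rule chain_of_nonzero)
      with False face_list_nth show False by (auto simp: faces_def)
    qed
    ultimately show ?thesis by simp
  qed
qed

lemma comb_lyubeznik:
  "comb (lyubeznik i) w r =
    (if r < length (face_list i) then boundary (length gs) (chain_of (Suc i) w) (face_list i ! r) else 0)"
proof (cases "r < length (face_list i)")
  case True
  let ?B = "face_list i ! r"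
  have B: "card ?B = i" "finite ?B" using face_list_nth[OF True] rooted_finite by auto
  have "boundary (length gs) (chain_of (Suc i) w) ?B =
      (\<Sum>l<length (face_list (Suc i)). \<Sum>x\<in>{..<length gs} - ?B.
        face_sign x ?B * (if face_list (Suc i) ! l = insert x ?B then w l else 0))"
    unfolding boundary_def chain_of_def sum_distrib_left by (rule sum.swap)
  also have "\<dots> = comb (lyubeznik i) w r"
    unfolding comb_def length_lyubeznik
  proof (intro sum.cong refl)
    fix l assume "l \<in> {..<length (face_list (Suc i))}"
    then have l: "l < length (face_list (Suc i))" by simp
    let ?C = "face_list (Suc i) ! l"
    have C: "card ?C = Suc i" "finite ?C" "?C \<subseteq> {..<length gs}"
      using face_list_nth[OF l] rooted_finite by (auto simp: rooted_def)
    show "(\<Sum>x\<in>{..<length gs} - ?B. face_sign x ?B * (if ?C = insert x ?B then w l else 0)) =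
        w l * snd (lyubeznik i ! l) r"
    proof (cases "?B \<subseteq> ?C")
      case True
      then have "card (?C - ?B) = 1" using B C by (simp add: card_Diff_subset)
      then obtain z where z: "?C - ?B = {z}" by (auto simp: card_1_singleton_iff)
      have "?C = insert x ?B \<longleftrightarrow> x = z" if "x \<notin> ?B" for x using z True that by blast
      then have "(\<Sum>x\<in>{..<length gs} - ?B. face_sign x ?B * (if ?C = insert x ?B then w l else 0)) =
          (\<Sum>x\<in>{..<length gs} - ?B. if x = z then face_sign z ?B * w l else 0)"
        by (intro sum.cong refl) auto
      also have "\<dots> = face_sign z ?B * w l" using z C(3) by (subst sum.delta) auto
      finally show ?thesis
        using True z \<open>r < length (face_list i)\<close> by (simp add: snd_lyubeznik[OF l])
    next
      case False
      then have "?C \<noteq> insert x ?B" for x by blast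
      then show ?thesis using False by (simp add: snd_lyubeznik[OF l])
    qed
  qed
  finally show ?thesis using True by simp
qed (simp add: comb_def snd_lyubeznik)

lemma boundary_chain_of:
  assumes "boundary N (chain_of (Suc k) w) B \<noteq> 0"
  shows "B \<in> faces k"
proof -
  obtain x where x: "x \<in> {..<N} - B" "face_sign x B * chain_of (Suc k) w (insert x B) \<noteq> 0"
    using assms unfolding boundary_def by (rule sum.not_neutral_contains_not_neutral)
  then have "chain_of (Suc k) w (insert x B) \<noteq> 0" by auto
  then obtain l where l: "l < length (face_list (Suc k))" "insert x B = face_list (Suc k) ! l"
    by (rule chain_of_nonzero)
  then have r: "rooted (insert x B)" "card (insert x B) = Suc k" using face_list_nth[OF l(1)] by simp_all
  then have "finite B" using rooted_finite by fastforce
  then show ?thesis using r x(1) rooted_subset[OF r(1)] by (auto simp: faces_def)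
qed

lemma chain_of_comb_lyubeznik:
  "chain_of (Suc i) (comb (lyubeznik (Suc i)) w) = boundary (length gs) (chain_of (Suc (Suc i)) w)"
proof -
  have "comb (lyubeznik (Suc i)) w = (\<lambda>l. if l < length (face_list (Suc i))
      then boundary (length gs) (chain_of (Suc (Suc i)) w) (face_list (Suc i) ! l) else 0)"
    by (rule ext) (simp add: comb_lyubeznik)
  then show ?thesis using chain_of_coords[OF boundary_chain_of] by simp
qed

text \<open>
  The rooted sets whose least common multiple divides \<open>u\<close> form a cone whose apex is the first
  generator dividing \<open>u\<close>.  This is what makes each strand of the Lyubeznik complex exact.
\<close>

context
  fixes u :: "'x mon" and q :: nat
  assumes q: "q < length gs" "gs ! q \<le> u" and first: "\<And>p. p < q \<Longrightarrow> \<not> gs ! p \<le> u"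
begin

lemma apex_below:
  assumes "finite B" "lcm_at B \<le> u" "y \<in> B"
  shows "q \<le> y"
proof (rule ccontr)
  assume "\<not> q \<le> y"
  then have "\<not> gs ! y \<le> u" by (intro first) simp
  moreover have "gs ! y \<le> u" using assms by (simp add: lcm_at_le_iff)
  ultimately show False by contradiction
qed

lemma rooted_insert_apex:
  assumes B: "rooted B" "lcm_at B \<le> u"
  shows "rooted (insert q B)"
  unfolding rooted_def
proof (intro conjI ballI allI impI)
  have fin: "finite B" using B rooted_finite by blast
  show "insert q B \<subseteq> {..<length gs}" using q B by (auto simp: rooted_def)
  fix b p assume b: "b \<in> insert q B" "p < b"
  show "\<not> gs ! p \<le> lcm_at {y \<in> insert q B. b \<le> y}"
  proof (cases "b = q")
    case True
    have "lcm_at {y \<in> insert q B. b \<le> y} \<le> u"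
      using fin B q by (subst lcm_at_le_iff) (auto simp: lcm_at_le_iff)
    then show ?thesis using first[of p] b True order_trans by blast
  next
    case False
    then have "q < b" using apex_below[OF fin B(2)] b by force
    then have "{y \<in> insert q B. b \<le> y} = {y \<in> B. b \<le> y}" by auto
    then show ?thesis using B(1) b False by (auto simp: rooted_def)
  qed
qed

text \<open>So a cycle in degree \<open>u\<close> bounds its cone with apex \<open>q\<close>, and this cone is again a chain of rooted
  sets in degree \<open>u\<close>.\<close>

lemma syz_lyubeznik_subset_image:
  assumes w: "w \<in> syz (lyubeznik i) u"
  shows "w \<in> comb (lyubeznik (Suc i)) ` {v. supported (map lcm_at (face_list (Suc (Suc i)))) u v}"
proof -
  define \<omega> where "\<omega> = chain_of (Suc i) w"
  have face: "C \<in> faces (Suc i) \<and> lcm_at C \<le> u" if "\<omega> C \<noteq> 0" for C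
  proof -
    from that obtain l where "l < length (face_list (Suc i))" "C = face_list (Suc i) ! l" "w l \<noteq> 0"
      unfolding \<omega>_def by (rule chain_of_nonzero)
    then show ?thesis using w face_list_nth
      by (auto simp: syz_def map_fst_lyubeznik supported_def faces_def)
  qed
  have fin: "finite C" if "\<omega> C \<noteq> 0" for C using face[OF that] rooted_finite by (auto simp: faces_def)
  have "boundary (length gs) \<omega> B = 0" for B
  proof (rule ccontr)
    assume n: "boundary (length gs) \<omega> B \<noteq> 0"
    then have "B \<in> faces i" unfolding \<omega>_def by (rule boundary_chain_of)
    then obtain r where r: "r < length (face_list i)" "B = face_list i ! r"
      using face_list(1)[of i] by (metis in_set_conv_nth)
    have "comb (lyubeznik i) w r = 0" using w by (simp add: syz_def)
    with n r show False by (simp add: comb_lyubeznik \<omega>_def)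
  qed
  note cycle = this
  define v where "v = (\<lambda>C. if q \<in> C then \<omega> (C - {q}) else 0)"
  have bv: "boundary (length gs) v = \<omega>"
  proof
    fix B
    show "boundary (length gs) v B = \<omega> B" unfolding v_def
    proof (rule boundary_cone[OF q(1) _ cycle])
      fix B y assume "\<omega> B \<noteq> 0" "y \<in> B"
      then show "q \<le> y" using apex_below[OF fin, of B y] face[of B] by simp
    qed
  qed
  have vface: "C \<in> faces (Suc (Suc i)) \<and> lcm_at C \<le> u" if "v C \<noteq> 0" for C
  proof -
    have C: "q \<in> C" "\<omega> (C - {q}) \<noteq> 0" using that by (auto simp: v_def split: if_splits)
    then have ins: "insert q (C - {q}) = C" by auto
    have "rooted C"
      using rooted_insert_apex[of "C - {q}"] face[OF C(2)] unfolding ins by (auto simp: faces_def)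
    moreover have "card C = Suc (Suc i)"
      using face[OF C(2)] card_insert_disjoint[OF fin[OF C(2)], of q] unfolding ins
      by (auto simp: faces_def)
    moreover have "lcm_at C \<le> u"
      using face[OF C(2)] fin[OF C(2)] q(2) lcm_at_le_iff[of C u] lcm_at_le_iff[of "C - {q}" u]
      by auto
    ultimately show ?thesis by (simp add: faces_def)
  qed
  define z where
    "z l = (if l < length (face_list (Suc (Suc i))) then v (face_list (Suc (Suc i)) ! l) else 0)" for l
  have "chain_of (Suc (Suc i)) z = v"
    unfolding z_def using vface by (intro chain_of_coords) blast
  then have "comb (lyubeznik (Suc i)) z l =
      (if l < length (face_list (Suc i)) then \<omega> (face_list (Suc i) ! l) else 0)" for l
    by (simp add: comb_lyubeznik bv)
  also have "\<dots> l = w l" for l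
    using w by (auto simp: \<omega>_def chain_of_face_list syz_def map_fst_lyubeznik supported_def)
  finally have "comb (lyubeznik (Suc i)) z = w" by (rule ext)
  moreover have "supported (map lcm_at (face_list (Suc (Suc i)))) u z"
    using vface by (auto simp: supported_def z_def split: if_splits)
  ultimately show ?thesis by blast
qed

end

lemma first_divisor:
  assumes "j < length gs" "gs ! j \<le> u"
  shows "\<exists>q < length gs. gs ! q \<le> u \<and> (\<forall>p<q. \<not> gs ! p \<le> u)"
proof -
  let ?q = "LEAST p. gs ! p \<le> u"
  have "?q \<le> j" "gs ! ?q \<le> u" using assms(2) by (auto intro: Least_le LeastI)
  moreover have "\<forall>p<?q. \<not> gs ! p \<le> u" using not_less_Least by blast
  ultimately show ?thesis using assms(1) order_le_less_trans by blast
qed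

theorem strand_resolution_lyubeznik:
  fixes I :: "('x, 'k::field) poly_ring set"
  assumes gs: "\<And>u. mono_poly u \<in> I \<longleftrightarrow> (\<exists>g \<in> set gs. g \<le> u)"
  shows "strand_resolution I lyubeznik"
  unfolding strand_resolution_def
proof (intro conjI allI)
  show "generates (lyubeznik 0) (ideal_strand I)"
    unfolding generates_def map_fst_lyubeznik
  proof (intro allI subset_antisym subsetI)
    fix u and w :: "nat \<Rightarrow> 'k"
    assume "w \<in> comb (lyubeznik 0) ` {w. supported (map lcm_at (face_list (Suc 0))) u w}"
    then obtain v where v: "w = comb (lyubeznik 0) v" "supported (map lcm_at (face_list (Suc 0))) u v" by blast
    have "r = 0 \<and> mono_poly u \<in> I" if wr: "w r \<noteq> 0" for r
    proof -
      obtain l where l: "l < length (face_list (Suc 0))" "v l * snd (lyubeznik 0 ! l) r \<noteq> 0"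
        using wr unfolding v(1) comb_def length_lyubeznik
        by (rule sum.not_neutral_contains_not_neutral) simp
      then have "lcm_at (face_list (Suc 0) ! l) \<le> u"
        using v(2) by (auto simp: supported_def)
      moreover obtain j where "face_list (Suc 0) ! l = {j}" "j < length gs"
        using face_list_nth[OF l(1)] by (auto simp: card_1_singleton_iff rooted_def)
      ultimately have "gs ! j \<le> u" "j < length gs" by (auto simp: lcm_at_le_iff)
      then have "mono_poly u \<in> I" unfolding gs by (auto intro!: bexI[of _ "gs ! j"])
      moreover have "r = 0" using l(2) by (auto simp: snd_lyubeznik[OF l(1)] face_list_0 split: if_splits)
      ultimately show ?thesis by blast
    qed
    then show "w \<in> ideal_strand I u" by (auto simp: ideal_strand_def)
  next
    fix u and w :: "nat \<Rightarrow> 'k"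
    assume w: "w \<in> ideal_strand I u"
    show "w \<in> comb (lyubeznik 0) ` {w. supported (map lcm_at (face_list (Suc 0))) u w}"
    proof (cases "w = 0")
      case True
      then show ?thesis by (intro image_eqI[of _ _ 0]) simp_all
    next
      case False
      then have "mono_poly u \<in> I" using w by (auto simp: ideal_strand_def fun_eq_iff)
      then obtain j where "j < length gs" "gs ! j \<le> u" unfolding gs by (auto simp: in_set_conv_nth)
      from first_divisor[OF this] obtain q where
        q: "q < length gs" "gs ! q \<le> u" "\<And>p. p < q \<Longrightarrow> \<not> gs ! p \<le> u" by blast
      have "rooted {}" "lcm_at {} \<le> u" by (simp_all add: rooted_def lcm_at_le_iff)
      from rooted_insert_apex[OF q this] have "{q} \<in> faces (Suc 0)" by (simp add: faces_def)
      then obtain l where l: "l < length (face_list (Suc 0))" "face_list (Suc 0) ! l = {q}"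
        using face_list(1)[of "Suc 0"] by (metis in_set_conv_nth)
      have "comb (lyubeznik 0) (\<lambda>j. if j = l then w 0 else 0) r = w 0 * snd (lyubeznik 0 ! l) r" for r
        using l(1) by (simp add: comb_def if_distrib[of "\<lambda>x. x * _"] cong: if_cong)
      also have "\<dots> r = w r" for r
        using w by (auto simp: snd_lyubeznik[OF l(1)] face_list_0 face_sign_def ideal_strand_def)
      finally have "comb (lyubeznik 0) (\<lambda>j. if j = l then w 0 else 0) = w" by (rule ext)
      moreover have "supported (map lcm_at (face_list (Suc 0))) u (\<lambda>j. if j = l then w 0 else 0)"
        using l q by (auto simp: supported_def lcm_at_le_iff)
      ultimately show ?thesis by (intro image_eqI) auto
    qed
  qed
next
  fix i
  show "generates (lyubeznik (Suc i)) (syz (lyubeznik i) :: _ \<Rightarrow> (nat \<Rightarrow> 'k) set)"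
    unfolding generates_def map_fst_lyubeznik
  proof (intro allI subset_antisym subsetI)
    fix u and w :: "nat \<Rightarrow> 'k"
    assume "w \<in> comb (lyubeznik (Suc i)) ` {w. supported (map lcm_at (face_list (Suc (Suc i)))) u w}"
    then obtain v where v: "w = comb (lyubeznik (Suc i)) v"
      "supported (map lcm_at (face_list (Suc (Suc i)))) u v" by blast
    have "r < length (face_list (Suc i)) \<and> lcm_at (face_list (Suc i) ! r) \<le> u" if wr: "w r \<noteq> 0" for r
    proof -
      obtain l where l: "l < length (face_list (Suc (Suc i)))" "v l * snd (lyubeznik (Suc i) ! l) r \<noteq> 0"
        using wr unfolding v(1) comb_def length_lyubeznik
        by (rule sum.not_neutral_contains_not_neutral) simp
      then have "lcm_at (face_list (Suc (Suc i)) ! l) \<le> u"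
        using v(2) by (auto simp: supported_def)
      moreover have "r < length (face_list (Suc i))" "face_list (Suc i) ! r \<subseteq> face_list (Suc (Suc i)) ! l"
        using l(2) by (auto simp: snd_lyubeznik[OF l(1)] split: if_splits)
      moreover have "finite (face_list (Suc (Suc i)) ! l)"
        using face_list_nth[OF l(1)] rooted_finite by blast
      ultimately show ?thesis using lcm_at_mono order_trans by blast
    qed
    moreover have "comb (lyubeznik i) w r = 0" for r
      unfolding comb_lyubeznik v(1) chain_of_comb_lyubeznik by (simp add: boundary_boundary)
    ultimately show "w \<in> syz (lyubeznik i) u"
      by (auto simp: syz_def map_fst_lyubeznik supported_def fun_eq_iff)
  next
    fix u and w :: "nat \<Rightarrow> 'k"
    assume w: "w \<in> syz (lyubeznik i) u"
    show "w \<in> comb (lyubeznik (Suc i)) ` {w. supported (map lcm_at (face_list (Suc (Suc i)))) u w}"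
    proof (cases "w = 0")
      case True
      then show ?thesis by (intro image_eqI[of _ _ 0]) simp_all
    next
      case False
      then obtain l where "w l \<noteq> 0" by (auto simp: fun_eq_iff)
      then have l: "l < length (face_list (Suc i))" "lcm_at (face_list (Suc i) ! l) \<le> u"
        using w by (auto simp: syz_def map_fst_lyubeznik supported_def)
      have C: "rooted (face_list (Suc i) ! l)" "card (face_list (Suc i) ! l) = Suc i"
        using face_list_nth[OF l(1)] by auto
      then obtain j where j: "j \<in> face_list (Suc i) ! l" by fastforce
      then have "j < length gs" "gs ! j \<le> u"
        using l(2) C lcm_at_le_iff[OF rooted_finite[OF C(1)], of u] by (auto simp: rooted_def)
      from first_divisor[OF this] obtain q where
        "q < length gs" "gs ! q \<le> u" "\<And>p. p < q \<Longrightarrow> \<not> gs ! p \<le> u" by blast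
      from syz_lyubeznik_subset_image[OF this w] show ?thesis by simp
    qed
  qed
qed

end


section \<open>Nonvanishing multidegrees from well ordered generators\<close>

context generator_list
begin

lemma strand_degs_lyubeznik: "strand_degs lyubeznik i = map lcm_at (face_list i)"
proof (cases i)
  case 0
  have "lcm_at {} = 0" by (simp add: lcm_at_def lcm_mon_def fun_eq_iff)
  then show ?thesis by (simp add: 0 strand_degs_def face_list_0)
qed (simp add: strand_degs_def map_fst_lyubeznik)

text \<open>An entry of the differential has the quotient of two least common multiples as its only
  monomial, so it is constant exactly if they agree.\<close>

lemma const_term_lyubeznik:
  assumes r: "r < length (face_list i)" and c: "c < length (face_list (Suc i))"
    and nz: "const_term (diff (complex_of \<delta> (lyubeznik :: _ \<Rightarrow> (_ \<times> (nat \<Rightarrow> 'k::field)) list)) i $$ (r, c)) \<noteq> 0"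
  shows "face_list i ! r \<subseteq> face_list (Suc i) ! c"
    and "lcm_at (face_list (Suc i) ! c) \<le> lcm_at (face_list i ! r)"
proof -
  have fst: "fst ((lyubeznik i :: (_ \<times> (nat \<Rightarrow> 'k)) list) ! c) = lcm_at (face_list (Suc i) ! c)"
    using c by (simp add: lyubeznik_def)
  have "diff (complex_of \<delta> lyubeznik) i $$ (r, c) =
      Poly_Mapping.single (lcm_at (face_list (Suc i) ! c) - lcm_at (face_list i ! r))
        (snd ((lyubeznik i :: (_ \<times> (nat \<Rightarrow> 'k)) list) ! c) r)"
    using r c by (subst diff_complex_of_entry)
      (simp_all add: rnk_complex_of strand_degs_lyubeznik fst)
  with nz have 0: "lcm_at (face_list (Suc i) ! c) - lcm_at (face_list i ! r) = 0"
    and s: "snd ((lyubeznik i :: (_ \<times> (nat \<Rightarrow> 'k)) list) ! c) r \<noteq> 0"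
    by (auto simp: lookup_single when_def split: if_splits)
  from 0 show "lcm_at (face_list (Suc i) ! c) \<le> lcm_at (face_list i ! r)"
    by (simp add: fun_eq_iff le_fun_def)
  from s show "face_list i ! r \<subseteq> face_list (Suc i) ! c"
    by (simp add: snd_lyubeznik[OF c] split: if_splits)
qed

end

lemma gens_squarefree:
  assumes "squarefree_monomial_ideal I" "g \<in> gens I"
  shows "g \<le> (\<lambda>_. 1)"
proof -
  obtain G where G: "\<forall>g\<in>G. squarefree_mon g" "I = ideal_gen (mono_poly ` G)"
    using assms(1) by (auto simp: squarefree_monomial_ideal_def)
  have "mono_poly g \<in> I" using assms(2) by (simp add: gens_def)
  then obtain h where h: "h \<in> G" "h \<le> g" unfolding G(2) mono_poly_in_ideal_gen_iff by blast
  then have "mono_poly h \<in> I" unfolding G(2) mono_poly_in_ideal_gen_iff by blast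
  with h assms(2) have "h = g" unfolding gens_def by blast
  with G(1) h(1) show ?thesis by (auto simp: squarefree_mon_def le_fun_def)
qed

lemma mono_poly_mem_iff_gens:
  fixes I :: "('x::finite, 'k::field) poly_ring set"
  assumes "squarefree_monomial_ideal I"
  shows "mono_poly u \<in> I \<longleftrightarrow> (\<exists>g \<in> gens I. g \<le> u)"
proof
  assume "\<exists>g \<in> gens I. g \<le> u"
  then obtain g where g: "mono_poly g \<in> I" "g \<le> u" by (auto simp: gens_def)
  obtain G where "I = ideal_gen (mono_poly ` G)"
    using assms by (auto simp: squarefree_monomial_ideal_def)
  with g show "mono_poly u \<in> I" by (auto simp: mono_poly_in_ideal_gen_iff intro: order_trans)
qed (rule gens_ideal_gen_le)

lemma gens_antichain: "g \<in> gens I \<Longrightarrow> h \<in> gens I \<Longrightarrow> h \<le> g \<Longrightarrow> h = g"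
  by (simp add: gens_def)

text \<open>
  Order the generators so that the sequence \<open>ns\<close> comes first.  Irredundancy makes the set \<open>A\<close> of
  its positions rooted, and no proper subset of \<open>A\<close> has the same least common multiple.  The
  ordering condition on \<open>ns\<close> says that adding a further generator \<open>n\<close> dividing the least
  common multiple destroys rootedness, so \<open>A\<close> is a facet among the rooted sets of this degree.
  Hence the basis element of the Lyubeznik resolution at \<open>A\<close> survives modulo the irrelevant ideal.
\<close>

theorem well_ordered_degree:
  fixes I :: "('x::finite, 'k::field) poly_ring set" and \<delta> :: "'x mon \<Rightarrow> 'd::comm_monoid_add"
  assumes \<delta>: "grading \<delta>" and I: "squarefree_monomial_ideal I"
    and F: "graded_free_resolution \<delta> I F"
    and ns: "distinct ns" "set ns \<subseteq> gens I" "ns \<noteq> []"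
    and irredundant: "\<And>c. c \<in> set ns \<Longrightarrow> \<not> c \<le> lcm_mon (set ns - {c})"
    and ordered: "\<And>n. n \<in> gens I \<Longrightarrow> n \<notin> set ns \<Longrightarrow> n \<le> lcm_mon (set ns) \<Longrightarrow>
      \<exists>j. Suc j < length ns \<and> ns ! j \<le> lcm_mon (insert n (set (drop (Suc j) ns)))"
  shows "\<delta> (lcm_mon (set ns)) \<in> set (degs F (length ns))"
proof -
  obtain G where G: "I = ideal_gen (mono_poly ` G)"
    using I by (auto simp: squarefree_monomial_ideal_def)
  have "finite (gens I)"
    using gens_squarefree[OF I] by (intro finite_subset[OF _ finite_below[of "\<lambda>_. 1"]]) auto
  then obtain os where os: "set os = gens I - set ns" "distinct os"
    using finite_distinct_list[of "gens I - set ns"] by auto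
  define gs where "gs = ns @ os"
  interpret generator_list gs .
  have set_gs: "set gs = gens I" using os ns by (auto simp: gs_def)
  obtain i where i: "length ns = Suc i" using ns(3) by (cases ns) auto
  define A where "A = {..<Suc i}"
  have nth_ns: "gs ! j = ns ! j" if "j < Suc i" for j using that i by (simp add: gs_def nth_append)
  have image_ns: "(!) gs ` {j..<Suc i} = set (drop j ns)" for j
  proof -
    have "(!) gs ` {j..<Suc i} = (!) ns ` {j..<length ns}" by (simp add: nth_ns i)
    also have "\<dots> = set (map ((!) ns) [j..<length ns])" by simp
    also have "map ((!) ns) [j..<length ns] = drop j ns" by (metis add_0 drop_map drop_upt map_nth)
    finally show ?thesis .
  qed
  have lcm_A: "lcm_at A = lcm_mon (set ns)"
    using image_ns[of 0] by (simp add: lcm_at_def A_def lessThan_atLeast0)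
  have others: "set (drop b ns) \<subseteq> set ns - {ns ! q}" if "q < b" "b \<le> length ns" for q b
  proof -
    have "ns ! q \<in> set (take b ns)" using that by (auto simp: in_set_conv_nth intro!: exI[of _ q])
    then show ?thesis
      using set_take_disj_set_drop_if_distinct[OF ns(1), of b b] set_drop_subset[of b ns] by auto
  qed
  have A: "rooted A"
    unfolding rooted_def
  proof (intro conjI ballI allI impI)
    show "A \<subseteq> {..<length gs}" using i by (auto simp: A_def gs_def)
    fix b q assume b: "b \<in> A" "q < b"
    then have "{y \<in> A. b \<le> y} = {b..<Suc i}" by (auto simp: A_def)
    then have "lcm_at {y \<in> A. b \<le> y} = lcm_mon (set (drop b ns))"
      by (simp add: lcm_at_def image_ns)
    also have "\<dots> \<le> lcm_mon (set ns - {ns ! q})"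
      using others[of q b] b i by (subst lcm_mon_le_iff) (auto simp: A_def intro!: lcm_mon_upper)
    finally have "lcm_at {y \<in> A. b \<le> y} \<le> lcm_mon (set ns - {ns ! q})" .
    moreover have "ns ! q \<in> set ns" using b i by (simp add: A_def)
    ultimately show "\<not> gs ! q \<le> lcm_at {y \<in> A. b \<le> y}"
      using irredundant[of "ns ! q"] nth_ns[of q] b order_trans by (auto simp: A_def)
  qed
  have "A \<in> faces (Suc i)" using A by (simp add: faces_def A_def)
  then obtain c where c: "c < length (face_list (Suc i))" "face_list (Suc i) ! c = A"
    using face_list(1)[of "Suc i"] by (metis in_set_conv_nth)
  let ?L = "complex_of \<delta> (lyubeznik :: nat \<Rightarrow> ('x mon \<times> (nat \<Rightarrow> 'k)) list)"
  have rnk: "rnk ?L k = length (face_list k)" for k by (simp add: rnk_complex_of strand_degs_lyubeznik)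
  have L: "graded_free_resolution \<delta> I ?L"
    by (rule grading.graded_free_resolution_complex_of[OF \<delta> G strand_resolution_lyubeznik])
      (simp add: set_gs mono_poly_mem_iff_gens[OF I])
  have "degs ?L (Suc i) ! c \<in> set (degs F (Suc i))"
  proof (rule grading.degree_in_every_resolution[OF \<delta> L F])
    show "c < rnk ?L (Suc i)" using c by (simp add: rnk)
  next
    fix r assume "r < rnk ?L i"
    then have r: "r < length (face_list i)" by (simp add: rnk)
    show "const_term (diff ?L i $$ (r, c)) = 0"
    proof (rule ccontr)
      assume "const_term (diff ?L i $$ (r, c)) \<noteq> 0"
      from const_term_lyubeznik[OF r c(1) this]
      have B: "face_list i ! r \<subseteq> A" "lcm_at A \<le> lcm_at (face_list i ! r)" by (simp_all add: c(2))
      have "face_list i ! r \<noteq> A" 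
      proof
        assume "face_list i ! r = A"
        then have "card A = i" using face_list_nth[OF r] by simp
        then show False by (simp add: A_def)
      qed
      then obtain z where z: "z \<in> A" "z \<notin> face_list i ! r" using B(1) by blast
      have "ns ! z \<in> set ns" using z(1) i by (simp add: A_def)
      then have "ns ! z \<le> lcm_mon (set ns)" by (simp add: lcm_mon_upper)
      also have "\<dots> \<le> lcm_at (face_list i ! r)" using B(2) by (simp add: lcm_A)
      also have "\<dots> \<le> lcm_mon (set ns - {ns ! z})"
      proof (subst lcm_at_le_iff)
        show "finite (face_list i ! r)" using face_list_nth[OF r] rooted_finite by blast
        show "\<forall>b\<in>face_list i ! r. gs ! b \<le> lcm_mon (set ns - {ns ! z})"
        proof
          fix b assume b: "b \<in> face_list i ! r"
          then have "b < length ns" "z < length ns" "b \<noteq> z" using B(1) z i by (auto simp: A_def)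
          then have "ns ! b \<in> set ns - {ns ! z}" using ns(1) by (auto simp: nth_eq_iff_index_eq)
          then show "gs ! b \<le> lcm_mon (set ns - {ns ! z})"
            using \<open>b < length ns\<close> i by (simp add: nth_ns lcm_mon_upper)
        qed
      qed
      finally show False using irredundant[OF \<open>ns ! z \<in> set ns\<close>] by contradiction
    qed
  next
    fix e assume "e < rnk ?L (Suc (Suc i))"
    then have e: "e < length (face_list (Suc (Suc i)))" by (simp add: rnk)
    show "const_term (diff ?L (Suc i) $$ (c, e)) = 0"
    proof (rule ccontr)
      define C where "C = face_list (Suc (Suc i)) ! e"
      have C: "rooted C" "card C = Suc (Suc i)" "finite C"
        using face_list_nth[OF e] rooted_finite by (auto simp: C_def)
      assume "const_term (diff ?L (Suc i) $$ (c, e)) \<noteq> 0"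
      from const_term_lyubeznik[OF c(1) e this]
      have AC: "A \<subseteq> C" "lcm_at C \<le> lcm_at A" by (simp_all add: c(2) C_def)
      have "card (C - A) = 1" using AC C by (simp add: card_Diff_subset A_def)
      then obtain x where x: "C - A = {x}" by (auto simp: card_1_singleton_iff)
      then have Cx: "C = insert x A" "x \<notin> A" using AC by auto
      then have xl: "Suc i \<le> x" "x < length gs" using C(1) by (auto simp: A_def rooted_def)
      define n where "n = gs ! x"
      have "n \<in> set os" using xl i by (simp add: n_def gs_def nth_append)
      then have n: "n \<in> gens I" "n \<notin> set ns" using os by auto
      have "n \<le> lcm_mon (set ns)"
        using AC(2) lcm_at_le_iff[OF C(3), of "lcm_at A"] Cx(1) by (simp add: n_def lcm_A)
      from ordered[OF n this] obtain j where j: "Suc j < length ns"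
        "ns ! j \<le> lcm_mon (insert n (set (drop (Suc j) ns)))" by blast
      have "{y \<in> C. Suc j \<le> y} = insert x {Suc j..<Suc i}" using Cx xl j i by (auto simp: A_def)
      then have "lcm_at {y \<in> C. Suc j \<le> y} = lcm_mon (insert n (set (drop (Suc j) ns)))"
        by (simp add: lcm_at_def image_ns n_def)
      then have "gs ! j \<le> lcm_at {y \<in> C. Suc j \<le> y}" using j i by (simp add: nth_ns)
      moreover have "Suc j \<in> C" using AC(1) j i by (auto simp: A_def)
      ultimately show False using C(1) by (auto simp: rooted_def)
    qed
  qed
  then show ?thesis using c by (simp add: complex_of_def strand_degs_lyubeznik lcm_A i)
qed


section \<open>Well ordered covers\<close>

text \<open>Leaving out \<open>c\<close> must uncover some variable.\<close>

lemma minimal_cover_private_variable: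
  assumes C: "is_minimal_cover I C" and c: "c \<in> C"
  obtains x where "c x \<noteq> 0" "\<And>d. d \<in> C \<Longrightarrow> d \<noteq> c \<Longrightarrow> d x = 0"
proof -
  have cov: "is_cover I C" and "\<not> is_cover I (C - {c})"
    using C c unfolding is_minimal_cover_def by blast+
  moreover from cov have "C - {c} \<subseteq> gens I" unfolding is_cover_def by blast
  ultimately have "\<exists>x. (\<exists>g\<in>gens I. g x \<noteq> 0) \<and> (\<forall>d\<in>C - {c}. d x = 0)"
    by (simp add: is_cover_def)
  then obtain x where x: "\<exists>g\<in>gens I. g x \<noteq> 0" "\<forall>d\<in>C - {c}. d x = 0" by (elim exE conjE)
  have "\<exists>d\<in>C. d x \<noteq> 0" using cov x(1) by (simp add: is_cover_def)
  then have "c x \<noteq> 0" using x(2) by (metis DiffI singletonD)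
  then show ?thesis using that[of x] x(2) by simp
qed

lemma minimal_cover_irredundant:
  assumes C: "is_minimal_cover I C" and c: "c \<in> C" and D: "finite D" "D \<subseteq> C - {c}"
  shows "\<not> c \<le> lcm_mon D"
proof
  assume le: "c \<le> lcm_mon D"
  obtain x where x: "c x \<noteq> 0" "\<And>d. d \<in> C \<Longrightarrow> d \<noteq> c \<Longrightarrow> d x = 0"
    using minimal_cover_private_variable[OF C c] by blast
  have "lcm_mon D x \<le> 0" using D x(2) by (subst lcm_mon_apply_le_iff) auto
  moreover have "c x \<le> lcm_mon D x" using le by (simp add: le_fun_def)
  ultimately show False using x(1) by simp
qed

text \<open>Members of the cover other than \<open>c\<close> do not involve its private variable, and neither does a
  monomial \<open>n\<close> that divides a least common multiple of such members.\<close>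

lemma minimal_cover_not_dvd:
  assumes C: "is_minimal_cover I C" and c: "c \<in> C"
    and D: "finite D" "D \<subseteq> C - {c}" and E: "finite E" "E \<subseteq> C - {c}" and n: "n \<le> lcm_mon E"
  shows "\<not> c \<le> lcm_mon (insert n D)"
proof
  assume le: "c \<le> lcm_mon (insert n D)"
  have "lcm_mon (insert n D) \<le> lcm_mon (D \<union> E)"
    using D(1) E(1) n lcm_mon_le_iff[of E "lcm_mon (D \<union> E)"]
    by (subst lcm_mon_le_iff) (auto intro: lcm_mon_upper order_trans)
  with le have "c \<le> lcm_mon (D \<union> E)" by (rule order_trans)
  moreover have "\<not> c \<le> lcm_mon (D \<union> E)" using C c D E by (intro minimal_cover_irredundant) auto
  ultimately show False by contradiction
qed

lemma distinct_nth_notin_drop: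
  assumes "distinct xs" "i < j" "i < length xs"
  shows "xs ! i \<notin> set (drop j xs)"
  using assms by (auto simp: in_set_conv_nth nth_eq_iff_index_eq)

text \<open>The index that the ordering condition of the whole cover provides lies in the tail: neither \<open>n\<close>
  nor the other members of the cover involve the private variable of a member of the head.\<close>

lemma well_ordered_tail:
  assumes w: "well_ordered_cover I ms"
    and n: "n \<in> gens I" "n \<notin> set (drop a ms)" "n \<le> lcm_mon (set (drop a ms))"
  shows "\<exists>j. Suc j < length (drop a ms) \<and>
    drop a ms ! j \<le> lcm_mon (insert n (set (drop (Suc j) (drop a ms))))"
proof -
  have d: "distinct ms" and C: "is_minimal_cover I (set ms)"
    using w by (auto simp: well_ordered_cover_def)
  have tail: "set (drop k ms) \<subseteq> set ms - {ms ! i}" if "i < k" "i < length ms" for i k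
    using distinct_nth_notin_drop[OF d that] set_drop_subset[of k ms] by auto
  have "n \<notin> set ms"
  proof
    assume "n \<in> set ms"
    then obtain i where i: "i < length ms" "n = ms ! i" by (auto simp: in_set_conv_nth)
    have "i < a"
    proof (rule ccontr)
      assume "\<not> i < a"
      then have "n = drop a ms ! (i - a)" "i - a < length (drop a ms)" using i by auto
      then show False using n(2) nth_mem by metis
    qed
    then show False
      using minimal_cover_irredundant[OF C, of "ms ! i" "set (drop a ms)"] tail[of i a] i n(3) by simp
  qed
  then obtain j where j: "Suc j < length ms" "ms ! j \<le> lcm_mon (insert n (set (drop (Suc j) ms)))"
    using w n(1) unfolding well_ordered_cover_def by blast
  have "a \<le> j"
  proof (rule ccontr)
    assume "\<not> a \<le> j"
    then have "\<not> ms ! j \<le> lcm_mon (insert n (set (drop (Suc j) ms)))"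
      using j(1) tail[of j "Suc j"] tail[of j a] n(3)
      by (intro minimal_cover_not_dvd[OF C, where E = "set (drop a ms)"]) auto
    with j(2) show False by contradiction
  qed
  with j show ?thesis by (intro exI[of _ "j - a"]) auto
qed

text \<open>
  The member \<open>ms ! j\<close> that the ordering condition of the whole cover provides for \<open>n\<close> cannot lie in
  the tail, whose members are coprime to \<open>n\<close> and have private variables.  So it is in the head,
  and by coprimality the tail does not contribute to the divisibility.  It is not the last member
  of the head either, which would then divide \<open>n\<close>.
\<close>

lemma well_ordered_head:
  assumes w: "well_ordered_cover I ms" and a: "a \<le> length ms"
    and coprime: "inf (lcm_mon (set (take a ms))) (lcm_mon (set (drop a ms))) = 0"
    and n: "n \<in> gens I" "n \<notin> set (take a ms)" "n \<le> lcm_mon (set (take a ms))"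
  shows "\<exists>j. Suc j < length (take a ms) \<and>
    take a ms ! j \<le> lcm_mon (insert n (set (drop (Suc j) (take a ms))))"
proof -
  have d: "distinct ms" and C: "is_minimal_cover I (set ms)"
    using w by (auto simp: well_ordered_cover_def)
  have sub: "set ms \<subseteq> gens I" using C by (simp add: is_minimal_cover_def is_cover_def)
  let ?m = "lcm_mon (set (take a ms))" and ?m' = "lcm_mon (set (drop a ms))"
  have zero: "?m x = 0 \<or> ?m' x = 0" for x
    using fun_cong[OF coprime, of x] by (auto simp: inf_min min_def split: if_splits)
  have head: "ms ! j \<le> ?m" if "j < a" "j < length ms" for j
    using that by (intro lcm_mon_upper) (auto simp: in_set_conv_nth intro!: exI[of _ j])
  have tail: "ms ! j \<le> ?m'" if "a \<le> j" "j < length ms" for j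
    using that by (intro lcm_mon_upper) (auto simp: in_set_conv_nth intro!: exI[of _ "j - a"])
  have priv: "\<exists>x. (ms ! j) x \<noteq> 0 \<and> (\<forall>k < length ms. k \<noteq> j \<longrightarrow> (ms ! k) x = 0)" if "j < length ms" for j
    using minimal_cover_private_variable[OF C nth_mem[OF that]] that d
    by (metis nth_eq_iff_index_eq nth_mem)
  have "n \<notin> set ms"
  proof
    assume "n \<in> set ms"
    then obtain i where i: "i < length ms" "n = ms ! i" by (auto simp: in_set_conv_nth)
    have "a \<le> i" using n(2) i by (metis in_set_conv_nth length_take min_less_iff_conj not_le nth_take)
    then have "n \<le> ?m'" using tail i by simp
    moreover obtain x where "n x \<noteq> 0" using priv[OF i(1)] i(2) by blast
    ultimately show False using zero[of x] n(3) by (auto simp: le_fun_def dest: spec[of _ x])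
  qed
  then obtain j where j: "Suc j < length ms" "ms ! j \<le> lcm_mon (insert n (set (drop (Suc j) ms)))"
    using w n(1) unfolding well_ordered_cover_def by blast
  have ja: "j < a"
  proof (rule ccontr)
    assume "\<not> j < a"
    obtain x where x: "(ms ! j) x \<noteq> 0" "\<And>k. k < length ms \<Longrightarrow> k \<noteq> j \<Longrightarrow> (ms ! k) x = 0"
      using priv[of j] j(1) by auto
    have "(ms ! j) x \<le> ?m' x" using tail[of j] \<open>\<not> j < a\<close> j(1) by (simp add: le_fun_def)
    then have "n x = 0" using zero[of x] x(1) n(3) by (auto simp: le_fun_def dest: spec[of _ x])
    moreover have "e x = 0" if "e \<in> set (drop (Suc j) ms)" for e
      using that x(2) by (auto simp: in_set_conv_nth)
    ultimately have "lcm_mon (insert n (set (drop (Suc j) ms))) x \<le> 0"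
      by (subst lcm_mon_apply_le_iff) auto
    with j(2) x(1) show False by (auto simp: le_fun_def dest: spec[of _ x])
  qed
  let ?N = "insert n (set (drop (Suc j) (take a ms)))"
  have le: "ms ! j \<le> lcm_mon ?N"
    unfolding le_fun_def
  proof
    fix x
    show "(ms ! j) x \<le> lcm_mon ?N x"
    proof (cases "(ms ! j) x = 0")
      case False
      have "(ms ! j) x \<le> ?m x" using head[OF ja] j(1) by (simp add: le_fun_def)
      with False zero[of x] have "?m' x = 0" by auto
      then have tail0: "e x = 0" if "e \<in> set (drop a ms)" for e
        using lcm_mon_upper[OF _ that] by (auto simp: le_fun_def dest: spec[of _ x])
      have "lcm_mon (insert n (set (drop (Suc j) ms))) x \<le> lcm_mon ?N x"
      proof (subst lcm_mon_apply_le_iff)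
        show "\<forall>e\<in>insert n (set (drop (Suc j) ms)). e x \<le> lcm_mon ?N x"
        proof
          fix e assume e: "e \<in> insert n (set (drop (Suc j) ms))"
          have "drop (Suc j) ms = drop (Suc j) (take a ms) @ drop a ms"
            using ja a
            by (metis Suc_leI append_take_drop_id drop_append diff_is_0_eq drop_0 length_take min.absorb2)
          with e have "e \<in> ?N \<or> e \<in> set (drop a ms)" by auto
          then show "e x \<le> lcm_mon ?N x"
          proof
            assume "e \<in> ?N"
            then have "e \<le> lcm_mon ?N" by (intro lcm_mon_upper) auto
            then show ?thesis by (simp add: le_fun_def)
          qed (simp add: tail0)
        qed
      qed simp
      moreover have "(ms ! j) x \<le> lcm_mon (insert n (set (drop (Suc j) ms))) x"
        using j(2) by (simp add: le_fun_def)
      ultimately show ?thesis by (rule order_trans[rotated])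
    qed simp
  qed
  have "Suc j \<noteq> a"
  proof
    assume "Suc j = a"
    then have "drop (Suc j) (take a ms) = []" by simp
    with le have "ms ! j \<le> lcm_mon {n}" by simp
    also have "\<dots> \<le> n" by (simp add: lcm_mon_le_iff)
    finally have "ms ! j = n" using gens_antichain[OF n(1)] sub j(1) by (metis Suc_lessD nth_mem subsetD)
    moreover have "ms ! j \<in> set ms" using j(1) by simp
    ultimately show False using \<open>n \<notin> set ms\<close> by simp
  qed
  with ja a le show ?thesis by (intro exI[of _ j]) auto
qed

section \<open>Betti numbers and lattice complements\<close>

lemma grading_fine: "grading (\<lambda>u. u)"
  by unfold_locales simp_all

lemma grading_total_deg: "grading (total_deg :: ('x::finite \<Rightarrow> nat) \<Rightarrow> nat)"
  by unfold_locales (simp_all add: total_deg_def sum.distrib)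

lemma betti_wrt_nonzero_iff:
  "betti_wrt \<delta> I i d \<noteq> 0 \<longleftrightarrow> d \<in> set (degs (SOME F. minimal_graded_free_resolution \<delta> I F) i)"
  by (simp add: betti_wrt_def count_list_0_iff)

theorem theorem4p7:
  fixes I :: "('x::finite, 'k::field) poly_ring set"
    and ms :: "'x mon list" and m m' :: "'x mon" and s a :: nat
  assumes "squarefree_monomial_ideal I"
    and "\<forall>x. \<exists>g\<in>gens I. g x \<noteq> 0"
    and "well_ordered_cover I ms" and "length ms = s"
    and "1 \<le> a" and "a \<le> s - 1"
    and "m = lcm_mon (set (take a ms))"
    and "m' = lcm_mon (set (drop a ms))"
    and "restrict_ideal I m = ideal_gen (mono_poly ` set (take a ms)) \<or> inf m m' = 0"
  shows "lattice_complements I m m' \<and>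
    multigraded_betti I a m \<noteq> 0 \<and>
    t_max I s \<le> t_max I a + t_max I (s - a)"
proof -
  note I = assms(1) and vars = assms(2) and w = assms(3) and s = assms(4) and m = assms(7) and m' = assms(8)
  have a: "1 \<le> a" "a < s" using assms(5,6) by auto
  have d: "distinct ms" and C: "is_minimal_cover I (set ms)"
    using w by (auto simp: well_ordered_cover_def)
  have cover: "set ms \<subseteq> gens I" "\<And>x. \<exists>c\<in>set ms. c x \<noteq> 0"
    using C vars by (auto simp: is_minimal_cover_def is_cover_def)
  have proper: "mono_poly 0 \<notin> I"
  proof
    assume "mono_poly 0 \<in> I"
    then have "g = 0" if "g \<in> gens I" for g
      using that by (force simp: gens_def le_fun_def)
    then show False using vars by force
  qed
  have irredundant: "\<not> c \<le> lcm_mon (set ns - {c})" if "set ns \<subseteq> set ms" "c \<in> set ns" for ns c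
    using that by (intro minimal_cover_irredundant[OF C]) auto
  have head_dvd: "g \<in> set (take a ms)"
    if eq: "restrict_ideal I m = ideal_gen (mono_poly ` set (take a ms))" and g: "g \<in> gens I" "g \<le> m" for g
  proof -
    have "mono_poly g \<in> restrict_ideal I m"
      using g unfolding restrict_ideal_def mono_poly_in_ideal_gen_iff by blast
    then obtain c where c: "c \<in> set (take a ms)" "c \<le> g"
      unfolding eq mono_poly_in_ideal_gen_iff by blast
    then have "c \<in> gens I" using cover(1) set_take_subset[of a ms] by auto
    then show ?thesis using gens_antichain[OF g(1) _ c(2)] c(1) by simp
  qed
  \<comment> \<open>if the head generates \<open>restrict_ideal I m\<close>, there is no such \<open>n\<close>\<close>
  have head_order: "\<exists>j. Suc j < length (take a ms) \<and>
      take a ms ! j \<le> lcm_mon (insert n (set (drop (Suc j) (take a ms))))"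
    if n: "n \<in> gens I" "n \<notin> set (take a ms)" "n \<le> lcm_mon (set (take a ms))" for n
    using assms(9)
  proof
    assume "restrict_ideal I m = ideal_gen (mono_poly ` set (take a ms))"
    from head_dvd[OF this n(1)] n(2,3) m show ?thesis by simp
  next
    assume "inf m m' = 0"
    then show ?thesis using well_ordered_head[OF w _ _ n] a s m m' by simp
  qed
  have full_order: "\<exists>j. Suc j < length ms \<and> ms ! j \<le> lcm_mon (insert n (set (drop (Suc j) ms)))"
    if "n \<in> gens I" "n \<notin> set ms" for n
    using w that unfolding well_ordered_cover_def by blast

  \<comment> \<open>a generator dividing \<open>m\<close> is in the head, so it has a private variable missing in \<open>m'\<close>; or the
    gcd is 1\<close>
  have complements: "lattice_complements I m m'"
    unfolding lattice_complements_def
  proof (intro conjI)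
    show "m \<in> LCM_lattice I" "m' \<in> LCM_lattice I"
      using cover(1) set_take_subset[of a ms] set_drop_subset[of a ms]
      unfolding m m' LCM_lattice_def by blast+
    show "sup m m' = (\<lambda>_. 1)"
    proof
      fix x
      have le: "c x \<le> 1" if "c \<in> set ms" for c
        using gens_squarefree[OF I, of c] cover(1) that by (auto simp: le_fun_def)
      have "m x \<le> 1" "m' x \<le> 1"
        unfolding m m' using le set_take_subset[of a ms] set_drop_subset[of a ms]
        by (subst lcm_mon_apply_le_iff; fastforce)+
      moreover obtain c where c: "c \<in> set ms" "c x \<noteq> 0" using cover(2) by blast
      moreover have "c \<in> set (take a ms) \<or> c \<in> set (drop a ms)"
        using c(1) by (metis Un_iff append_take_drop_id set_append)
      then have "c \<le> m \<or> c \<le> m'" 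
        unfolding m m' using lcm_mon_upper[of "set (take a ms)" c] lcm_mon_upper[of "set (drop a ms)" c]
        by auto
      then have "c x \<le> m x \<or> c x \<le> m' x" by (auto simp: le_fun_def)
      ultimately show "sup m m' x = 1" by (auto simp: sup_max)
    qed
    show "mono_poly (inf m m') \<notin> I"
    proof
      assume inI: "mono_poly (inf m m') \<in> I"
      then obtain g where g: "g \<in> gens I" "g \<le> inf m m'" using gens_ideal_gen_le by blast
      from assms(9) show False
      proof
        assume "restrict_ideal I m = ideal_gen (mono_poly ` set (take a ms))"
        from head_dvd[OF this g(1)] g(2) have gh: "g \<in> set (take a ms)" by simp
        then have "set (drop a ms) \<subseteq> set ms - {g}"
          using set_take_disj_set_drop_if_distinct[OF d order_refl, of a] set_drop_subset[of a ms] by auto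
        then have "\<not> g \<le> m'"
          unfolding m' using gh set_take_subset[of a ms] by (intro minimal_cover_irredundant[OF C]) auto
        with g(2) show False by simp
      next
        assume "inf m m' = 0"
        with inI proper show False by simp
      qed
    qed
  qed

  have head_degree: "\<delta> m \<in> set (degs F a)"
    if "grading \<delta>" "graded_free_resolution \<delta> I F"
    for \<delta> :: "'x mon \<Rightarrow> 'd::comm_monoid_add" and F
  proof -
    have "\<delta> (lcm_mon (set (take a ms))) \<in> set (degs F (length (take a ms)))"
      using d cover(1) set_take_subset[of a ms] a s head_order
      by (intro well_ordered_degree[OF that(1) I that(2)] irredundant) auto
    then show ?thesis using a s m by simp
  qed

  define Ff where "Ff = (SOME F. minimal_graded_free_resolution (\<lambda>u. u) I F)"
  have "minimal_graded_free_resolution (\<lambda>u. u) I Ff"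
    unfolding Ff_def using minimal_resolution_exists[OF grading_fine I proper] by (metis someI_ex)
  then have "m \<in> set (degs Ff a)"
    using head_degree[OF grading_fine] by (simp add: minimal_graded_free_resolution_def)
  then have betti: "multigraded_betti I a m \<noteq> 0"
    unfolding multigraded_betti_def betti_wrt_nonzero_iff Ff_def .

  \<comment> \<open>\<open>F'\<close> is a minimal resolution known to have squarefree multidegrees; the degrees of \<open>F\<close> occur in it\<close>
  define F where "F = (SOME F. minimal_graded_free_resolution total_deg I F)"
  obtain F' where F': "minimal_graded_free_resolution total_deg I F'"
    "\<forall>i. \<forall>d \<in> set (degs F' i). \<exists>u \<le> (\<lambda>_ :: 'x. 1). d = total_deg u"
    using minimal_resolution_exists[OF grading_total_deg I proper] by blast
  have minF: "minimal_graded_free_resolution total_deg I F"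
    using F'(1) unfolding F_def by (rule someI)
  then have F: "graded_free_resolution total_deg I F" by (simp add: minimal_graded_free_resolution_def)
  have t: "t_max I i = Max (set (degs F i))" for i
    unfolding t_max_def graded_betti_def betti_wrt_nonzero_iff F_def by simp
  have "total_deg m \<le> t_max I a"
    unfolding t using head_degree[OF grading_total_deg F] by simp
  moreover have "total_deg m' \<le> t_max I (s - a)"
  proof -
    have "total_deg (lcm_mon (set (drop a ms))) \<in> set (degs F (length (drop a ms)))"
    proof (rule well_ordered_degree[OF grading_total_deg I F])
      show "set (drop a ms) \<subseteq> gens I" using cover(1) set_drop_subset[of a ms] by blast
      show "\<not> c \<le> lcm_mon (set (drop a ms) - {c})" if "c \<in> set (drop a ms)" for c
        by (rule irredundant[OF set_drop_subset that])
      show "\<exists>j. Suc j < length (drop a ms) \<and>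
          drop a ms ! j \<le> lcm_mon (insert n (set (drop (Suc j) (drop a ms))))"
        if "n \<in> gens I" "n \<notin> set (drop a ms)" "n \<le> lcm_mon (set (drop a ms))" for n
        by (rule well_ordered_tail[OF w that])
    qed (use d a s in simp_all)
    then show ?thesis unfolding t using s m' by simp
  qed
  moreover have "t_max I s \<le> card (UNIV :: 'x set)"
  proof -
    have "total_deg (lcm_mon (set ms)) \<in> set (degs F (length ms))"
      using d cover(1) a s full_order
      by (intro well_ordered_degree[OF grading_total_deg I F] irredundant) auto
    then have ne: "set (degs F s) \<noteq> {}" using s by auto
    obtain i where i: "s = Suc i" using a by (cases s) auto
    have "e \<le> card (UNIV :: 'x set)" if e: "e \<in> set (degs F s)" for e
    proof -
      obtain c where c: "c < rnk F (Suc i)" "degs F (Suc i) ! c = e"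
        using e by (auto simp: in_set_conv_nth rnk_def i)
      have "degs F (Suc i) ! c \<in> set (degs F' (Suc i))"
      proof (rule grading.degree_in_every_resolution[OF grading_total_deg F _ c(1)])
        show "graded_free_resolution total_deg I F'"
          using F'(1) by (simp add: minimal_graded_free_resolution_def)
      qed (use minF c(1) in \<open>auto simp: minimal_graded_free_resolution_def intro!: const_term_irrelevant\<close>)
      then obtain u :: "'x mon" where u: "u \<le> (\<lambda>_. 1)" "e = total_deg u" using F'(2) c(2) by blast
      have "(\<Sum>x\<in>UNIV. u x) \<le> (\<Sum>x\<in>(UNIV :: 'x set). 1)"
        using u(1) by (intro sum_mono) (simp add: le_fun_def)
      then show ?thesis by (simp add: u(2) total_deg_def)
    qed
    with ne show ?thesis unfolding t by simp
  qed
  moreover have "card (UNIV :: 'x set) \<le> total_deg m + total_deg m'"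
  proof -
    have "card (UNIV :: 'x set) = (\<Sum>x\<in>UNIV. sup m m' x)"
      using complements by (simp add: lattice_complements_def)
    also have "\<dots> \<le> (\<Sum>x\<in>UNIV. m x + m' x)" by (intro sum_mono) (simp add: sup_max)
    finally show ?thesis by (simp add: total_deg_def sum.distrib)
  qed
  ultimately have "t_max I s \<le> t_max I a + t_max I (s - a)" by linarith
  with complements betti show ?thesis by blast
qed

end
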